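(* Let $G$ be a finitely generated nilpotent FC-group and let $H$ be a finitely generated group with $G\approx H$, i.e. $\mathrm{Con}(G)=\mathrm{Con}(H)$. Then $H$ is also a nilpotent FC-group. Furthermore, $Z(G)\cong Z(H)$ and $G/Z(G)\cong H/Z(H)$, and $G$ and $H$ have the same Hirsch length.
   Context: Let $G$ be a finitely generated group. Given a finite generating sequence $\mathfrak g=(g_1,\dots,g_n)$ of $G$ and a finite (indexed) partition $\mathcal E=\{E_1,\dots,E_m\}$ of $G$ into nonempty, pairwise disjoint subsets, a configuration corresponding to $(\mathfrak g,\mathcal E)$ is an $(n+1)$-tuple $C=(c_0,c_1,\dots,c_n)$ with $1\le c_i\le m$ for each $i$ such that there is $x\in G$ with $x\in E_{c_0}$ and $g_ix\in E_{c_i}$ for each $1\le i\le n$. The set of all configurations corresponding to $(\mathfrak g,\mathcal E)$ is denoted $\mathrm{Con}(\mathfrak g,\mathcal E)$, and $\mathrm{Con}(G)$ denotes the set of all $\mathrm{Con}(\mathfrak g,\mathcal E)$ as $\mathfrak g$ runs over the finite generating sequences of $G$ and $\mathcal E$ over the finite partitions of $G$. Finitely generated groups $G_1,G_2$ are called configuration equivalent, written $G_1\approx G_2$, if $\mathrm{Con}(G_1)=\mathrm{Con}(G_2)$. An FC-group is a group in which each element has only finitely many conjugates. $Z(G)$ denotes the center of $G$. The Hirsch length of a polycyclic group (in particular, of a finitely generated nilpotent group) is the number of infinite factors in a series with cyclic factors; it is independent of the series. *)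

theory Defs
  imports "HOL-Algebra.Algebra"
begin

definition finitely_generated_group :: "('a, 'm) monoid_scheme \<Rightarrow> bool" where
  "finitely_generated_group G \<longleftrightarrow>
     (\<exists>S. finite S \<and> S \<subseteq> carrier G \<and> generate G S = carrier G)"

definition generating_sequence :: "('a, 'm) monoid_scheme \<Rightarrow> 'a list \<Rightarrow> bool" where
  "generating_sequence G gs \<longleftrightarrow> set gs \<subseteq> carrier G \<and> generate G (set gs) = carrier G"

definition indexed_partition :: "('a, 'm) monoid_scheme \<Rightarrow> 'a set list \<Rightarrow> bool" where
  "indexed_partition G Es \<longleftrightarrow>
     (\<Union>E\<in>set Es. E) = carrier G \<and>
     (\<forall>i<length Es. Es ! i \<noteq> {}) \<and>
     (\<forall>i<length Es. \<forall>j<length Es. i \<noteq> j \<longrightarrow> Es ! i \<inter> Es ! j = {})"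

text \<open>
  A configuration \<open>(c\<^sub>0, \<dots>, c\<^sub>n)\<close> is the list \<open>cs\<close> of its entries, which range over \<open>{1..m}\<close>.
  Lists are indexed from 0, so the block \<open>E\<^sub>c\<close> is \<open>Es ! (c - 1)\<close> and \<open>g\<^sub>i\<close> is \<open>gs ! (i - 1)\<close>,
  whereas \<open>c\<^sub>i\<close> is \<open>cs ! i\<close>.
\<close>

definition configuration ::
  "('a, 'm) monoid_scheme \<Rightarrow> 'a list \<Rightarrow> 'a set list \<Rightarrow> nat list \<Rightarrow> bool" where
  "configuration G gs Es cs \<longleftrightarrow>
     length cs = length gs + 1 \<and>
     set cs \<subseteq> {1..length Es} \<and>
     (\<exists>x\<in>carrier G.
        x \<in> Es ! (cs ! 0 - 1) \<and>
        (\<forall>i\<in>{1..length gs}. gs ! (i - 1) \<otimes>\<^bsub>G\<^esub> x \<in> Es ! (cs ! i - 1)))"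

definition Con :: "('a, 'm) monoid_scheme \<Rightarrow> 'a list \<Rightarrow> 'a set list \<Rightarrow> nat list set" where
  "Con G gs Es = {cs. configuration G gs Es cs}"

definition Con_group :: "('a, 'm) monoid_scheme \<Rightarrow> nat list set set" where
  "Con_group G = {Con G gs Es | gs Es. generating_sequence G gs \<and> indexed_partition G Es}"

definition configuration_equivalent ::
  "('a, 'm) monoid_scheme \<Rightarrow> ('b, 'n) monoid_scheme \<Rightarrow> bool" where
  "configuration_equivalent G H \<longleftrightarrow> Con_group G = Con_group H"

definition center :: "('a, 'm) monoid_scheme \<Rightarrow> 'a set" where
  "center G = {z \<in> carrier G. \<forall>g\<in>carrier G. z \<otimes>\<^bsub>G\<^esub> g = g \<otimes>\<^bsub>G\<^esub> z}"

definition FC_group :: "('a, 'm) monoid_scheme \<Rightarrow> bool" where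
  "FC_group G \<longleftrightarrow>
     (\<forall>x\<in>carrier G. finite {g \<otimes>\<^bsub>G\<^esub> x \<otimes>\<^bsub>G\<^esub> inv\<^bsub>G\<^esub> g | g. g \<in> carrier G})"

primrec lower_central :: "('a, 'm) monoid_scheme \<Rightarrow> nat \<Rightarrow> 'a set" where
  "lower_central G 0 = carrier G"
| "lower_central G (Suc k) =
     generate G {x \<otimes>\<^bsub>G\<^esub> y \<otimes>\<^bsub>G\<^esub> inv\<^bsub>G\<^esub> x \<otimes>\<^bsub>G\<^esub> inv\<^bsub>G\<^esub> y | x y.
                   x \<in> lower_central G k \<and> y \<in> carrier G}"

definition nilpotent_group :: "('a, 'm) monoid_scheme \<Rightarrow> bool" where
  "nilpotent_group G \<longleftrightarrow> (\<exists>k. lower_central G k = {\<one>\<^bsub>G\<^esub>})"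

definition cyclic_series :: "('a, 'm) monoid_scheme \<Rightarrow> 'a set list \<Rightarrow> bool" where
  "cyclic_series G Ks \<longleftrightarrow>
     Ks \<noteq> [] \<and> hd Ks = {\<one>\<^bsub>G\<^esub>} \<and> last Ks = carrier G \<and>
     (\<forall>K\<in>set Ks. subgroup K G) \<and>
     (\<forall>i. Suc i < length Ks \<longrightarrow>
        Ks ! i \<lhd> G\<lparr>carrier := Ks ! Suc i\<rparr> \<and>
        cyclic_group (G\<lparr>carrier := Ks ! Suc i\<rparr> Mod Ks ! i))"

definition infinite_factor_count :: "('a, 'm) monoid_scheme \<Rightarrow> 'a set list \<Rightarrow> nat" where
  "infinite_factor_count G Ks =
     card {i. Suc i < length Ks \<and> infinite (carrier (G\<lparr>carrier := Ks ! Suc i\<rparr> Mod Ks ! i))}"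

text \<open>
  Meaningful for polycyclic groups only: these have a cyclic series, and any two cyclic series
  have the same number of infinite factors.
\<close>

definition hirsch_length :: "('a, 'm) monoid_scheme \<Rightarrow> nat" where
  "hirsch_length G = (THE h. \<exists>Ks. cyclic_series G Ks \<and> infinite_factor_count G Ks = h)"

end

theory Submission
  imports Defs
begin

text \<open>
  A configuration set records which star-shaped colour patterns occur when a Cayley graph is
  coloured with finitely many colours.  Giving finitely many points of \<open>G\<close> their own colours and
  colouring by the cosets of a finite-index normal subgroup \<open>N\<close> as well, one finds for every
  generating tuple \<open>g\<close> of \<open>G\<close> a generating tuple \<open>h\<close> of \<open>H\<close> such that finitely many prescribed
  inequations \<open>w(g) \<noteq> 1\<close> pass to \<open>h\<close>, while \<open>w(h) = 1\<close> implies \<open>w(g) \<in> N\<close> for all words \<open>w\<close>.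

  Noncentrality is an inequation, so the finite groups \<open>G/Z(G)\<close> and \<open>H/Z(H)\<close> have the same order
  and can be matched so that \<open>w(g) \<in> Z(G)\<close> iff \<open>w(h) \<in> Z(H)\<close>.  With \<open>N = Z(G)\<^sup>n\<close> this gives
  \<open>|Z(G)/Z(G)\<^sup>n| \<le> |Z(H)/Z(H)\<^sup>n|\<close>, hence equality, and these orders determine the invariant factors
  of a finitely generated abelian group.  The Hirsch length is the rank of the centre.
\<close>

section \<open>Words and colourings\<close>

text \<open>Nothing says that a relation satisfied by \<open>g\<close> is satisfied by
  \<open>h\<close>, and \<open>h\<close> depends on the chosen inequations and on \<open>N\<close>;
  so a transfer yields no homomorphism between \<open>G\<close> and \<open>H\<close>. This obstacle
  shapes the proof. Claims are reduced to counting, and an equality of orders comes from two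
  unrelated transfers, one in each direction. In particular the isomorphism of the centres is not
  induced by words. The two kinds of transferred information differ for a reason. Private colours
  identify only finitely many points, hence serve only finitely many words. Coset colours are
  coarse, but they can be followed along every word, because left multiplication acts on the cosets
  of a normal subgroup. The comparison of indices needs centrality to agree on all words: an n-th
  root in Z(H) is the value of some word v, and only if v(g) is central as well does v(g)^n lie in
  Z(G)^n.\<close>

type_synonym word = "(bool \<times> nat) list"

primrec letter_value :: "('a, 'm) monoid_scheme \<Rightarrow> 'a list \<Rightarrow> bool \<times> nat \<Rightarrow> 'a" where
  "letter_value G gs (b, i) = (if b then gs ! i else inv\<^bsub>G\<^esub> (gs ! i))"

primrec word_value :: "('a, 'm) monoid_scheme \<Rightarrow> 'a list \<Rightarrow> word \<Rightarrow> 'a" where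
  "word_value G gs [] = \<one>\<^bsub>G\<^esub>"
| "word_value G gs (a # w) = letter_value G gs a \<otimes>\<^bsub>G\<^esub> word_value G gs w"

definition words :: "nat \<Rightarrow> word set" where
  "words n = {w. snd ` set w \<subseteq> {..<n}}"

definition inverse_word :: "word \<Rightarrow> word" where
  "inverse_word w = rev (map (map_prod Not id) w)"

lemma words_simps [simp]:
  "[] \<in> words n"
  "a # w \<in> words n \<longleftrightarrow> snd a < n \<and> w \<in> words n"
  "u @ w \<in> words n \<longleftrightarrow> u \<in> words n \<and> w \<in> words n"
  "inverse_word w \<in> words n \<longleftrightarrow> w \<in> words n"
  by (auto simp: words_def inverse_word_def image_image)

context group
begin

lemma letter_value_closed:
  assumes "set gs \<subseteq> carrier G" "snd a < length gs"
  shows "letter_value G gs a \<in> carrier G"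
proof -
  have "gs ! snd a \<in> carrier G" using assms by auto
  then show ?thesis by (cases a) auto
qed

lemma word_value_closed:
  assumes "set gs \<subseteq> carrier G" "w \<in> words (length gs)"
  shows "word_value G gs w \<in> carrier G"
  using assms(2) by (induction w) (auto intro!: letter_value_closed assms(1))

lemma word_value_append:
  assumes "set gs \<subseteq> carrier G" "u \<in> words (length gs)" "w \<in> words (length gs)"
  shows "word_value G gs (u @ w) = word_value G gs u \<otimes> word_value G gs w"
  using assms(2)
  by (induction u) (auto simp: assms m_assoc letter_value_closed word_value_closed)

lemma word_value_inverse:
  assumes "set gs \<subseteq> carrier G" "w \<in> words (length gs)"
  shows "word_value G gs (inverse_word w) = inv (word_value G gs w)"
  using assms(2)
proof (induction w)
  case Nil
  then show ?case by (simp add: inverse_word_def)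
next
  case (Cons a w)
  have [simp]: "inverse_word (a # w) = inverse_word w @ [map_prod Not id a]"
    by (simp add: inverse_word_def)
  have a: "letter_value G gs a \<in> carrier G" and w: "word_value G gs w \<in> carrier G"
    using Cons.prems by (auto intro!: letter_value_closed word_value_closed assms(1))
  have "letter_value G gs (map_prod Not id a) = inv (letter_value G gs a)"
    using assms(1) Cons.prems by (cases a) (auto simp: subset_iff)
  moreover have "word_value G gs (inverse_word w @ [map_prod Not id a])
      = word_value G gs (inverse_word w) \<otimes> word_value G gs [map_prod Not id a]"
    by (rule word_value_append) (use assms Cons.prems in \<open>auto simp: map_prod_def split: prod.splits\<close>)
  ultimately show ?case
    using Cons a w by (simp add: inv_mult_group)
qed

lemma generating_sequenceD:
  "generating_sequence G gs \<Longrightarrow> set gs \<subseteq> carrier G"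
  by (simp add: generating_sequence_def)

lemma word_value_surj:
  assumes "generating_sequence G gs" "x \<in> carrier G"
  obtains w where "w \<in> words (length gs)" "word_value G gs w = x"
proof -
  have gs: "set gs \<subseteq> carrier G" "x \<in> generate G (set gs)"
    using assms by (auto simp: generating_sequence_def)
  have single: "\<exists>i. i < length gs \<and> gs ! i = h" if "h \<in> set gs" for h
    using that by (simp add: in_set_conv_nth)
  from gs(2) have "\<exists>w\<in>words (length gs). word_value G gs w = x"
  proof induction
    case one
    show ?case by (intro bexI[of _ "[]"]) auto
  next
    case (incl h)
    then obtain i where "i < length gs" "gs ! i = h" using single by blast
    then show ?case using incl gs by (intro bexI[of _ "[(True, i)]"]) auto
  next
    case (inv h)
    then obtain i where "i < length gs" "gs ! i = h" using single by blast
    then show ?case using inv gs by (intro bexI[of _ "[(False, i)]"]) auto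
  next
    case (eng h1 h2)
    then obtain u w where "u \<in> words (length gs)" "word_value G gs u = h1"
      "w \<in> words (length gs)" "word_value G gs w = h2" by blast
    then show ?case
      using word_value_append[OF gs(1)] by (intro bexI[of _ "u @ w"]) auto
  qed
  then show ?thesis using that by blast
qed

end

text \<open>The colour classes of \<chi> form a partition, and its configuration set with
  \<open>gs\<close> is by assumption that of some \<open>hs\<close> with a partition
  \<open>Fs\<close> of \<open>H\<close>. Colouring \<open>H\<close> by the blocks of
  \<open>Fs\<close>, with colour names taken from \<chi>, makes equality of the two sets say that
  stars in \<open>H\<close> look like stars in \<open>G\<close>, and that no colour of
  \<open>G\<close> is missing in \<open>H\<close>.\<close>

lemma colouring_transfer:
  fixes G :: "('a, 'm) monoid_scheme" and H :: "('b, 'n) monoid_scheme" and \<chi> :: "'a \<Rightarrow> 'c"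
  assumes "group G" "group H" and eq: "Con_group G = Con_group H"
    and gs: "generating_sequence G gs" and fin: "finite (\<chi> ` carrier G)"
  obtains hs \<chi>' where "generating_sequence H hs" "length hs = length gs"
    "\<And>y. y \<in> carrier H \<Longrightarrow> \<exists>x\<in>carrier G. \<chi>' y = \<chi> x \<and>
        (\<forall>i<length gs. \<chi>' (hs ! i \<otimes>\<^bsub>H\<^esub> y) = \<chi> (gs ! i \<otimes>\<^bsub>G\<^esub> x))"
    "\<And>x. x \<in> carrier G \<Longrightarrow> \<exists>y\<in>carrier H. \<chi>' y = \<chi> x"
proof -
  interpret G: group G by fact
  interpret H: group H by fact
  have gsG: "set gs \<subseteq> carrier G" using gs by (rule G.generating_sequenceD)
  obtain cols where cols: "set cols = \<chi> ` carrier G" "distinct cols"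
    using finite_distinct_list[OF fin] by blast
  define Es where "Es = map (\<lambda>c. {x \<in> carrier G. \<chi> x = c}) cols"
  have Es_nth: "Es ! j = {x \<in> carrier G. \<chi> x = cols ! j}" if "j < length cols" for j
    using that by (simp add: Es_def)
  have len: "length Es = length cols" by (simp add: Es_def)
  have "indexed_partition G Es"
    unfolding indexed_partition_def
  proof (intro conjI allI impI)
    show "(\<Union>E\<in>set Es. E) = carrier G"
      using cols(1) by (auto simp: Es_def)
    show "Es ! i \<noteq> {}" if "i < length Es" for i
    proof -
      have "cols ! i \<in> \<chi> ` carrier G" using that len cols(1) nth_mem by fastforce
      then show ?thesis using that len by (auto simp: Es_nth)
    qed
    show "Es ! i \<inter> Es ! j = {}" if "i < length Es" "j < length Es" "i \<noteq> j" for i j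
      using that len cols(2) by (auto simp: Es_nth nth_eq_iff_index_eq)
  qed
  then have "Con G gs Es \<in> Con_group G"
    using gs unfolding Con_group_def by blast
  then have "Con G gs Es \<in> Con_group H" by (simp only: eq)
  then obtain hs Fs where con: "Con G gs Es = Con H hs Fs"
    and hs: "generating_sequence H hs" and Fs: "indexed_partition H Fs"
    unfolding Con_group_def by blast
  have hsH: "set hs \<subseteq> carrier H" using hs by (rule H.generating_sequenceD)
  define idx where "idx y = (SOME j. j < length Fs \<and> y \<in> Fs ! j)" for y
  have idx: "idx y < length Fs \<and> y \<in> Fs ! idx y" if "y \<in> carrier H" for y
  proof -
    have "y \<in> \<Union>(set Fs)" using Fs that by (simp add: indexed_partition_def)
    then have "\<exists>j. j < length Fs \<and> y \<in> Fs ! j" by (auto simp: in_set_conv_nth)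
    then show ?thesis unfolding idx_def by (rule someI_ex)
  qed
  have idx_unique: "idx y = j" if "j < length Fs" "y \<in> Fs ! j" "y \<in> carrier H" for y j
    using idx[OF that(3)] that Fs unfolding indexed_partition_def by blast
  define \<chi>' where "\<chi>' y = cols ! idx y" for y
  have fwd: "length hs = length gs \<and> (\<exists>x\<in>carrier G. \<chi>' y = \<chi> x \<and>
        (\<forall>i<length hs. \<chi>' (hs ! i \<otimes>\<^bsub>H\<^esub> y) = \<chi> (gs ! i \<otimes>\<^bsub>G\<^esub> x)))"
    if y: "y \<in> carrier H" for y
  proof -
    \<comment> \<open>\<open>Suc\<close> passes from list positions to configuration entries, which
      start at 1.\<close>
    define cs where "cs = Suc (idx y) # map (\<lambda>h. Suc (idx (h \<otimes>\<^bsub>H\<^esub> y))) hs"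
    have hy: "h \<otimes>\<^bsub>H\<^esub> y \<in> carrier H" if "h \<in> set hs" for h using that y hsH by auto
    have "configuration H hs Fs cs"
      unfolding configuration_def
    proof (intro conjI)
      show "length cs = length hs + 1" by (simp add: cs_def)
      show "set cs \<subseteq> {1..length Fs}"
        using idx y hy by (auto simp: cs_def Suc_le_eq)
      show "\<exists>x\<in>carrier H. x \<in> Fs ! (cs ! 0 - 1) \<and>
          (\<forall>i\<in>{1..length hs}. hs ! (i - 1) \<otimes>\<^bsub>H\<^esub> x \<in> Fs ! (cs ! i - 1))"
        using idx y hy by (intro bexI[of _ y]) (auto simp: cs_def nth_Cons')
    qed
    then have "cs \<in> Con H hs Fs" by (simp add: Con_def)
    then have "configuration G gs Es cs" unfolding con[symmetric] by (simp add: Con_def)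
    then obtain x where l: "length cs = length gs + 1" and r: "set cs \<subseteq> {1..length Es}"
      and x: "x \<in> carrier G" "x \<in> Es ! (cs ! 0 - 1)"
        "\<And>i. i \<in> {1..length gs} \<Longrightarrow> gs ! (i - 1) \<otimes>\<^bsub>G\<^esub> x \<in> Es ! (cs ! i - 1)"
      unfolding configuration_def by blast
    \<comment> \<open>The lengths are compared through one configuration that lies in both sets; the
      unit of \<open>H\<close> will provide it.\<close>
    have lgs: "length hs = length gs" using l by (simp add: cs_def)
    \<comment> \<open>A priori \<open>Fs\<close> might be longer than \<open>cols\<close>. As a
      configuration of \<open>G\<close>, the list \<open>cs\<close> keeps the block numbers in
      range, so \<open>\<chi>'\<close> never reads past the end of \<open>cols\<close>.\<close>
    have r0: "idx y < length cols" using r by (simp add: cs_def len Suc_le_eq)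
    have ri: "idx (hs ! i \<otimes>\<^bsub>H\<^esub> y) < length cols" if "i < length hs" for i
      using r that by (auto simp: cs_def len Suc_le_eq image_subset_iff)
    have "\<chi>' y = \<chi> x" using x(2) r0 by (simp add: cs_def Es_nth \<chi>'_def)
    moreover have "\<chi>' (hs ! i \<otimes>\<^bsub>H\<^esub> y) = \<chi> (gs ! i \<otimes>\<^bsub>G\<^esub> x)" if "i < length hs" for i
      using x(3)[of "Suc i"] that ri[OF that] lgs by (simp add: cs_def Es_nth \<chi>'_def)
    ultimately show ?thesis using lgs x(1) by blast
  qed
  have bwd: "\<exists>y\<in>carrier H. \<chi>' y = \<chi> x" if x: "x \<in> carrier G" for x
  proof -
    have "\<exists>j<length cols. cols ! j = \<chi> u" if "u \<in> carrier G" for u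
      using that cols(1) by (metis image_eqI in_set_conv_nth)
    then obtain J where J: "\<And>u. u \<in> carrier G \<Longrightarrow> J u < length cols \<and> cols ! J u = \<chi> u"
      by metis
    have gx: "g \<otimes>\<^bsub>G\<^esub> x \<in> carrier G" if "g \<in> set gs" for g using that x gsG by auto
    define cs where "cs = Suc (J x) # map (\<lambda>g. Suc (J (g \<otimes>\<^bsub>G\<^esub> x))) gs"
    have "configuration G gs Es cs"
      unfolding configuration_def
    proof (intro conjI)
      show "length cs = length gs + 1" by (simp add: cs_def)
      show "set cs \<subseteq> {1..length Es}"
        using J x gx by (auto simp: cs_def len Suc_le_eq)
      show "\<exists>x\<in>carrier G. x \<in> Es ! (cs ! 0 - 1) \<and>
          (\<forall>i\<in>{1..length gs}. gs ! (i - 1) \<otimes>\<^bsub>G\<^esub> x \<in> Es ! (cs ! i - 1))"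
        using J x gx by (intro bexI[of _ x]) (auto simp: cs_def nth_Cons' Es_nth)
    qed
    then have "cs \<in> Con G gs Es" by (simp add: Con_def)
    then have "configuration H hs Fs cs" unfolding con by (simp add: Con_def)
    then obtain y where "set cs \<subseteq> {1..length Fs}" "y \<in> carrier H" "y \<in> Fs ! (cs ! 0 - 1)"
      unfolding configuration_def by blast
    then have "y \<in> carrier H" "idx y = J x"
      using idx_unique[of "J x" y] by (auto simp: cs_def)
    then show ?thesis using J[OF x] by (intro bexI[of _ y]) (auto simp: \<chi>'_def)
  qed
  show ?thesis
  proof (rule that)
    show "generating_sequence H hs" by fact
    show "length hs = length gs" using fwd[OF H.one_closed] by blast
    show "\<exists>x\<in>carrier G. \<chi>' y = \<chi> x \<and>
        (\<forall>i<length gs. \<chi>' (hs ! i \<otimes>\<^bsub>H\<^esub> y) = \<chi> (gs ! i \<otimes>\<^bsub>G\<^esub> x))" if "y \<in> carrier H" for y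
      using fwd[OF that] by auto
  qed (use bwd in blast)
qed

section \<open>Transfer of inequations and of coset information along words\<close>

definition commutator_word :: "word \<Rightarrow> word \<Rightarrow> word" where
  "commutator_word u v = u @ v @ inverse_word u @ inverse_word v"

lemma (in group) word_value_commutator:
  assumes "set gs \<subseteq> carrier G" "u \<in> words (length gs)" "v \<in> words (length gs)"
  shows "word_value G gs (commutator_word u v) = \<one> \<longleftrightarrow>
    word_value G gs u \<otimes> word_value G gs v = word_value G gs v \<otimes> word_value G gs u"
proof -
  let ?x = "word_value G gs u" and ?y = "word_value G gs v"
  have c: "?x \<in> carrier G" "?y \<in> carrier G" using assms by (auto simp: word_value_closed)
  have "word_value G gs (commutator_word u v) = ?x \<otimes> ?y \<otimes> inv (?y \<otimes> ?x)"
    using assms c by (simp add: commutator_word_def word_value_append word_value_inverse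
        inv_mult_group m_assoc)
  then show ?thesis
    using c inv_solve_right[of \<one> "?x \<otimes> ?y" "?y \<otimes> ?x"] by (auto simp: eq_commute)
qed

lemma (in normal) rcos_mult_cong:
  assumes "x \<in> carrier G" "y \<in> carrier G" "g \<in> carrier G" "H #> x = H #> y"
  shows "H #> (g \<otimes> x) = H #> (g \<otimes> y)"
  using assms by (metis rcos_sum)

text \<open>
  Points of \<open>B\<close> have private colours, so a path through \<open>B\<close> spelled by a word can be followed in
  \<open>H\<close> letter by letter; for an inverse letter one reads the pattern at its end point.
\<close>

lemma word_transfer:
  fixes G :: "('a, 'm) monoid_scheme" and H :: "('b, 'n) monoid_scheme"
  assumes "group G" "group H" "Con_group G = Con_group H"
    and gs: "generating_sequence G gs"
    and "N \<lhd> G" and finN: "finite (rcosets\<^bsub>G\<^esub> N)"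
    and U: "finite U" "U \<subseteq> words (length gs)"
  obtains hs where "generating_sequence H hs" "length hs = length gs"
    "\<And>u. u \<in> U \<Longrightarrow> word_value G gs u \<notin> center G \<Longrightarrow> word_value H hs u \<notin> center H"
    "\<And>w. w \<in> words (length gs) \<Longrightarrow> word_value H hs w = \<one>\<^bsub>H\<^esub> \<Longrightarrow> word_value G gs w \<in> N"
proof -
  interpret G: group G by fact
  interpret H: group H by fact
  interpret N: normal N G by fact
  let ?n = "length gs" and ?g = "word_value G gs"
  have gsG: "set gs \<subseteq> carrier G" using gs by (rule G.generating_sequenceD)
  \<comment> \<open>Noncentrality becomes a single inequation: some element does not commute with
    the value of \<open>u\<close>, and that element is the value of a word \<open>v\<close>.\<close>
  have "\<exists>v\<in>words ?n. ?g (commutator_word u v) \<noteq> \<one>\<^bsub>G\<^esub>"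
    if "u \<in> words ?n" "?g u \<notin> center G" for u
  proof -
    have "?g u \<in> carrier G" using gsG that(1) by (rule G.word_value_closed)
    then have "\<exists>y\<in>carrier G. ?g u \<otimes>\<^bsub>G\<^esub> y \<noteq> y \<otimes>\<^bsub>G\<^esub> ?g u"
      using that(2) by (simp add: center_def)
    then obtain y where "y \<in> carrier G" "?g u \<otimes>\<^bsub>G\<^esub> y \<noteq> y \<otimes>\<^bsub>G\<^esub> ?g u" ..
    moreover obtain v where "v \<in> words ?n" "?g v = y"
      using G.word_value_surj[OF gs \<open>y \<in> carrier G\<close>] .
    ultimately show ?thesis
      using G.word_value_commutator[OF gsG that(1)] by auto
  qed
  then obtain V where V: "\<And>u. u \<in> words ?n \<Longrightarrow> ?g u \<notin> center G \<Longrightarrow>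
      V u \<in> words ?n \<and> ?g (commutator_word u (V u)) \<noteq> \<one>\<^bsub>G\<^esub>"
    by metis
  define W where "W = (\<lambda>u. commutator_word u (V u)) ` {u \<in> U. ?g u \<notin> center G}"
  \<comment> \<open>Values are built by multiplication on the left, so the path from the unit to the
    value of \<open>w\<close> runs through the values of the suffixes of \<open>w\<close>.\<close>
  define B where "B = (\<Union>w\<in>W. (\<lambda>k. ?g (drop k w)) ` {..length w})"
  have "finite B" using U by (auto simp: B_def W_def)
  \<comment> \<open>The first component pins down the finitely many points of \<open>B\<close>; the
    second is coarse but informative everywhere.\<close>
  define \<chi> where "\<chi> x = (if x \<in> B then Some x else None, N #>\<^bsub>G\<^esub> x)" for x
  have "\<chi> ` carrier G \<subseteq> insert None (Some ` B) \<times> rcosets\<^bsub>G\<^esub> N"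
    by (auto simp: \<chi>_def RCOSETS_def)
  then have fin\<chi>: "finite (\<chi> ` carrier G)"
    by (rule finite_subset) (use \<open>finite B\<close> finN in auto)
  obtain hs \<chi>' where hs: "generating_sequence H hs" and len: "length hs = ?n"
    and pat: "\<And>y. y \<in> carrier H \<Longrightarrow> \<exists>x\<in>carrier G. \<chi>' y = \<chi> x \<and>
        (\<forall>i<?n. \<chi>' (hs ! i \<otimes>\<^bsub>H\<^esub> y) = \<chi> (gs ! i \<otimes>\<^bsub>G\<^esub> x))"
    and onto: "\<And>x. x \<in> carrier G \<Longrightarrow> \<exists>y\<in>carrier H. \<chi>' y = \<chi> x"
    by (rule colouring_transfer[OF assms(1-4) fin\<chi>]) (rule that)
  have hsH: "set hs \<subseteq> carrier H" using hs by (rule H.generating_sequenceD)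
  have gi: "gs ! i \<in> carrier G" and hi: "hs ! i \<in> carrier H" if "i < ?n" for i
    using that gsG hsH len by auto
  \<comment> \<open>The unit of \<open>H\<close> need not carry the colour of the unit of
    \<open>G\<close>. Paths in \<open>H\<close> start at some \<open>y\<^sub>0\<close> that does,
    and word values appear translated by it.\<close>
  obtain y\<^sub>0 where y\<^sub>0: "y\<^sub>0 \<in> carrier H" "\<chi>' y\<^sub>0 = \<chi> \<one>\<^bsub>G\<^esub>"
    using onto[OF G.one_closed] by blast
  have special: "fst (\<chi>' (letter_value H hs a \<otimes>\<^bsub>H\<^esub> y)) = Some (letter_value G gs a \<otimes>\<^bsub>G\<^esub> x)"
    if asm: "snd a < ?n" "y \<in> carrier H" "fst (\<chi>' y) = Some x"
      "letter_value G gs a \<otimes>\<^bsub>G\<^esub> x \<in> B" for a y x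
  proof (cases a)
    case (Pair b i)
    with asm(1) have i: "i < ?n" by simp
    note gi = gi[OF i] and hi = hi[OF i]
    show ?thesis
    proof (cases b)
      case True
      obtain x' where "x' \<in> carrier G" "\<chi>' y = \<chi> x'" "\<chi>' (hs ! i \<otimes>\<^bsub>H\<^esub> y) = \<chi> (gs ! i \<otimes>\<^bsub>G\<^esub> x')"
        using pat[OF asm(2)] i by blast
      then show ?thesis
        using asm(3,4) Pair True by (auto simp: \<chi>_def split: if_splits)
    next
      case False
      let ?y = "inv\<^bsub>H\<^esub> (hs ! i) \<otimes>\<^bsub>H\<^esub> y"
      have "?y \<in> carrier H" using hi asm(2) by simp
      then obtain x' where x': "x' \<in> carrier G" "\<chi>' ?y = \<chi> x'"
          "\<chi>' (hs ! i \<otimes>\<^bsub>H\<^esub> ?y) = \<chi> (gs ! i \<otimes>\<^bsub>G\<^esub> x')"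
        using pat[of ?y] i by blast
      have "hs ! i \<otimes>\<^bsub>H\<^esub> ?y = y" using hi asm(2) by (simp flip: H.m_assoc)
      with x'(3) asm(3) have "gs ! i \<otimes>\<^bsub>G\<^esub> x' = x"
        by (auto simp: \<chi>_def split: if_splits)
      then have "x' = inv\<^bsub>G\<^esub> (gs ! i) \<otimes>\<^bsub>G\<^esub> x"
        using gi x'(1) G.inv_solve_left[of x' "gs ! i" x] by auto
      then show ?thesis
        using asm(4) x'(2) Pair False by (auto simp: \<chi>_def)
    qed
  qed
  have path: "fst (\<chi>' (word_value H hs w \<otimes>\<^bsub>H\<^esub> y\<^sub>0)) = Some (?g w)"
    if "w \<in> words ?n" "\<forall>k\<le>length w. ?g (drop k w) \<in> B" for w
    using that
  proof (induction w)
    case Nil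
    then show ?case using y\<^sub>0 by (simp add: \<chi>_def)
  next
    case (Cons a w)
    from Cons.prems(2) have "\<forall>k\<le>length w. ?g (drop k w) \<in> B"
      by (metis Suc_le_mono drop_Suc_Cons length_Cons)
    then have IH: "fst (\<chi>' (word_value H hs w \<otimes>\<^bsub>H\<^esub> y\<^sub>0)) = Some (?g w)"
      using Cons by simp
    have w: "word_value H hs w \<in> carrier H" and a: "letter_value H hs a \<in> carrier H"
      using Cons.prems by (auto simp: len intro!: H.word_value_closed H.letter_value_closed hsH)
    have "?g (a # w) \<in> B" using Cons.prems(2) by (metis drop0 le0)
    then have "fst (\<chi>' (letter_value H hs a \<otimes>\<^bsub>H\<^esub> (word_value H hs w \<otimes>\<^bsub>H\<^esub> y\<^sub>0))) = Some (?g (a # w))"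
      using special[OF _ _ IH, of a] Cons.prems(1) w y\<^sub>0(1) by simp
    then show ?case using a w y\<^sub>0(1) by (simp add: H.m_assoc)
  qed
  \<comment> \<open>Left multiplication respects the cosets of a normal subgroup, so this step works
    at every point, and by induction for every word.\<close>
  have coset: "snd (\<chi>' (letter_value H hs a \<otimes>\<^bsub>H\<^esub> y)) = N #>\<^bsub>G\<^esub> (letter_value G gs a \<otimes>\<^bsub>G\<^esub> x)"
    if asm: "snd a < ?n" "y \<in> carrier H" "snd (\<chi>' y) = N #>\<^bsub>G\<^esub> x" "x \<in> carrier G" for a y x
  proof (cases a)
    case (Pair b i)
    with asm(1) have i: "i < ?n" by simp
    note gi = gi[OF i] and hi = hi[OF i]
    show ?thesis
    proof (cases b)
      case True
      obtain x' where "x' \<in> carrier G" "\<chi>' y = \<chi> x'" "\<chi>' (hs ! i \<otimes>\<^bsub>H\<^esub> y) = \<chi> (gs ! i \<otimes>\<^bsub>G\<^esub> x')"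
        using pat[OF asm(2)] i by blast
      then show ?thesis
        using asm(3,4) gi Pair True N.rcos_mult_cong[of x' x "gs ! i"] by (auto simp: \<chi>_def)
    next
      case False
      let ?y = "inv\<^bsub>H\<^esub> (hs ! i) \<otimes>\<^bsub>H\<^esub> y"
      have "?y \<in> carrier H" using hi asm(2) by simp
      then obtain x' where x': "x' \<in> carrier G" "\<chi>' ?y = \<chi> x'"
          "\<chi>' (hs ! i \<otimes>\<^bsub>H\<^esub> ?y) = \<chi> (gs ! i \<otimes>\<^bsub>G\<^esub> x')"
        using pat[of ?y] i by blast
      have "hs ! i \<otimes>\<^bsub>H\<^esub> ?y = y" using hi asm(2) by (simp flip: H.m_assoc)
      with x'(3) asm(3) have "N #>\<^bsub>G\<^esub> (gs ! i \<otimes>\<^bsub>G\<^esub> x') = N #>\<^bsub>G\<^esub> x"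
        by (auto simp: \<chi>_def)
      then have "N #>\<^bsub>G\<^esub> (inv\<^bsub>G\<^esub> (gs ! i) \<otimes>\<^bsub>G\<^esub> (gs ! i \<otimes>\<^bsub>G\<^esub> x')) = N #>\<^bsub>G\<^esub> (inv\<^bsub>G\<^esub> (gs ! i) \<otimes>\<^bsub>G\<^esub> x)"
        using gi x'(1) asm(4) by (intro N.rcos_mult_cong) auto
      then show ?thesis
        using gi x'(1,2) Pair False by (simp add: \<chi>_def flip: G.m_assoc)
    qed
  qed
  have coset_path: "snd (\<chi>' (word_value H hs w \<otimes>\<^bsub>H\<^esub> y\<^sub>0)) = N #>\<^bsub>G\<^esub> ?g w"
    if "w \<in> words ?n" for w
    using that
  proof (induction w)
    case Nil
    then show ?case using y\<^sub>0 by (simp add: \<chi>_def)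
  next
    case (Cons a w)
    have w: "word_value H hs w \<in> carrier H" and a: "letter_value H hs a \<in> carrier H"
      using Cons.prems by (auto simp: len intro!: H.word_value_closed H.letter_value_closed hsH)
    have "snd (\<chi>' (letter_value H hs a \<otimes>\<^bsub>H\<^esub> (word_value H hs w \<otimes>\<^bsub>H\<^esub> y\<^sub>0))) = N #>\<^bsub>G\<^esub> ?g (a # w)"
      using coset[of a "word_value H hs w \<otimes>\<^bsub>H\<^esub> y\<^sub>0" "?g w"] Cons w y\<^sub>0(1) gsG
      by (simp add: G.word_value_closed)
    then show ?case using a w y\<^sub>0(1) by (simp add: H.m_assoc)
  qed
  show ?thesis
  proof (rule that[OF hs len])
    fix u assume u: "u \<in> U" "?g u \<notin> center G"
    let ?w = "commutator_word u (V u)"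
    have words: "u \<in> words ?n" "V u \<in> words ?n" and ne: "?g ?w \<noteq> \<one>\<^bsub>G\<^esub>" using u U V by auto
    have w: "?w \<in> words ?n" using words by (simp add: commutator_word_def)
    have "?w \<in> W" using u by (auto simp: W_def)
    then have B: "\<forall>k\<le>length ?w. ?g (drop k ?w) \<in> B" by (auto simp: B_def)
    then have "?g (drop (length ?w) ?w) \<in> B" by blast
    then have "fst (\<chi>' y\<^sub>0) = Some \<one>\<^bsub>G\<^esub>" using y\<^sub>0 by (simp add: \<chi>_def)
    \<comment> \<open>A trivial value in \<open>H\<close> would give \<open>y\<^sub>0\<close> the
      private colours of two points, the unit and the nontrivial value of \<open>?w\<close> in
      \<open>G\<close>.\<close>
    then have "word_value H hs ?w \<noteq> \<one>\<^bsub>H\<^esub>"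
      using path[OF w B] ne y\<^sub>0(1) by auto
    then show "word_value H hs u \<notin> center H"
      using H.word_value_commutator[OF hsH, of u "V u"] words H.word_value_closed[OF hsH, of "V u"]
      by (auto simp: center_def len)
  next
    fix w assume w: "w \<in> words ?n" and "word_value H hs w = \<one>\<^bsub>H\<^esub>"
    then have "N #>\<^bsub>G\<^esub> ?g w = N #>\<^bsub>G\<^esub> \<one>\<^bsub>G\<^esub>"
      using coset_path[OF w] y\<^sub>0 by (simp add: \<chi>_def)
    then show "?g w \<in> N"
      using G.word_value_closed[OF gsG w] G.coset_join1[of N "?g w"] N.is_subgroup N.subset
      by simp
  qed
qed

section \<open>The centre and its index\<close>

text \<open>On \<open>A\<close> the function \<open>g\<close> factors through \<open>f\<close>.
  Instances bound cosets of the centre by conjugates, and conjugates by such cosets.\<close>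

lemma finite_image_factor:
  assumes "finite (f ` A)" "\<And>x y. x \<in> A \<Longrightarrow> y \<in> A \<Longrightarrow> f x = f y \<Longrightarrow> g x = g y"
  shows "finite (g ` A)"
proof (rule finite_surj[OF assms(1)])
  have "g x = g (inv_into A f (f x))" if "x \<in> A" for x
    using that by (intro assms(2)) (auto simp: inv_into_into f_inv_into_f)
  then show "g ` A \<subseteq> (\<lambda>v. g (inv_into A f v)) ` f ` A" by blast
qed

section \<open>Cosets, commuting elements and the centre\<close>

lemma (in group) mult_inv_cancel:
  assumes "x \<in> carrier G" "y \<in> carrier G"
  shows "inv x \<otimes> (x \<otimes> y) = y" "x \<otimes> (inv x \<otimes> y) = y"
  using assms by (simp_all flip: m_assoc)

lemma (in group) rcos_eq_iff:
  assumes "subgroup K G" "x \<in> carrier G" "y \<in> carrier G"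
  shows "K #> x = K #> y \<longleftrightarrow> x \<otimes> inv y \<in> K"
proof -
  have "K #> x = K #> y \<longleftrightarrow> x \<in> K #> y"
    using assms rcos_self[of x K] repr_independence[of x K y] by auto
  also have "\<dots> \<longleftrightarrow> x \<otimes> inv y \<in> K"
    using subgroup.rcos_module[OF assms(1) is_group assms(3,2)] .
  finally show ?thesis .
qed

lemma (in group) rcosets_image: "rcosets K = (\<lambda>x. K #> x) ` carrier G"
  by (auto simp: RCOSETS_def)

lemma (in group) commutes_inv:
  assumes "x \<in> carrier G" "y \<in> carrier G" "x \<otimes> y = y \<otimes> x"
  shows "x \<otimes> inv y = inv y \<otimes> x"
proof -
  have "inv y \<otimes> (x \<otimes> y) \<otimes> inv y = inv y \<otimes> (y \<otimes> x) \<otimes> inv y" using assms(3) by simp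
  then show ?thesis using assms(1,2) by (simp add: m_assoc mult_inv_cancel)
qed

lemma (in group) commutes_mult:
  assumes "x \<in> carrier G" "y \<in> carrier G" "z \<in> carrier G"
    "x \<otimes> y = y \<otimes> x" "x \<otimes> z = z \<otimes> x"
  shows "x \<otimes> (y \<otimes> z) = y \<otimes> z \<otimes> x"
proof -
  have "x \<otimes> (y \<otimes> z) = x \<otimes> y \<otimes> z" using assms(1-3) by (simp only: m_assoc)
  also have "\<dots> = y \<otimes> (x \<otimes> z)" using assms(1-3) by (simp only: assms(4) m_assoc)
  also have "\<dots> = y \<otimes> z \<otimes> x" using assms(1-3) by (simp only: assms(5) m_assoc)
  finally show ?thesis .
qed

lemma (in group) commutes_generate:
  assumes "x \<in> carrier G" "S \<subseteq> carrier G" "\<And>s. s \<in> S \<Longrightarrow> x \<otimes> s = s \<otimes> x" "y \<in> generate G S"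
  shows "x \<otimes> y = y \<otimes> x"
  using assms(4)
proof induction
  case one
  then show ?case using assms(1) by simp
next
  case (incl h)
  then show ?case by (rule assms(3))
next
  case (inv h)
  then show ?case using assms(1-3) by (intro commutes_inv) auto
next
  case (eng h1 h2)
  have "h1 \<in> carrier G" "h2 \<in> carrier G"
    using eng generate_in_carrier[OF assms(2)] by auto
  then show ?case using assms(1) eng by (intro commutes_mult) auto
qed

lemma (in group) center_subset: "center G \<subseteq> carrier G"
  by (auto simp: center_def)

lemma (in group) centerD: "z \<in> center G \<Longrightarrow> g \<in> carrier G \<Longrightarrow> z \<otimes> g = g \<otimes> z"
  by (simp add: center_def)

lemma (in group) center_subgroup: "subgroup (center G) G"
proof (rule subgroupI)
  show "center G \<subseteq> carrier G" by (rule center_subset)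
  show "center G \<noteq> {}" using one_closed by (auto simp: center_def)
  fix z assume z: "z \<in> center G"
  then have zG: "z \<in> carrier G" using center_subset by auto
  have "inv z \<otimes> g = g \<otimes> inv z" if g: "g \<in> carrier G" for g
    by (rule commutes_inv[OF g zG centerD[OF z g, symmetric], symmetric])
  then show "inv z \<in> center G" using zG by (auto simp: center_def)
  fix y assume y: "y \<in> center G"
  then have yG: "y \<in> carrier G" using center_subset by auto
  have "z \<otimes> y \<otimes> g = g \<otimes> (z \<otimes> y)" if g: "g \<in> carrier G" for g
    by (rule commutes_mult[OF g zG yG centerD[OF z g, symmetric] centerD[OF y g, symmetric], symmetric])
  then show "z \<otimes> y \<in> center G" using zG yG by (auto simp: center_def)
qed

lemma (in group) normal_central_subgroup:
  assumes "subgroup N G" "N \<subseteq> center G"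
  shows "N \<lhd> G"
  unfolding normal_inv_iff
proof (intro conjI ballI)
  fix x h assume x: "x \<in> carrier G" and h: "h \<in> N"
  have hG: "h \<in> carrier G" using h assms center_subset by auto
  have "x \<otimes> h = h \<otimes> x" using centerD[of h x] h x assms(2) by auto
  then have "x \<otimes> h \<otimes> inv x = h" using x hG by (simp add: m_assoc)
  with h show "x \<otimes> h \<otimes> inv x \<in> N" by simp
qed (fact assms)

text \<open>Conjugation by \<open>x\<close> is determined by the conjugates of finitely many
  generators, which by the FC property take finitely many values. Elements that conjugate the
  generators alike differ by one that commutes with all generators, hence by a central one.\<close>

lemma (in group) center_finite_index:
  assumes "finitely_generated_group G" "FC_group G"
  shows "finite (rcosets (center G))"
proof -
  obtain S where S: "finite S" "S \<subseteq> carrier G" "generate G S = carrier G"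
    using assms(1) by (auto simp: finitely_generated_group_def)
  define f where "f x = (\<lambda>s\<in>S. x \<otimes> s \<otimes> inv x)" for x
  have "f ` carrier G \<subseteq> (\<Pi>\<^sub>E s\<in>S. {x \<otimes> s \<otimes> inv x | x. x \<in> carrier G})"
    by (auto simp: f_def)
  moreover have "finite (\<Pi>\<^sub>E s\<in>S. {x \<otimes> s \<otimes> inv x | x. x \<in> carrier G})"
    using S assms(2) by (intro finite_PiE) (auto simp: FC_group_def)
  ultimately have "finite (f ` carrier G)" by (rule finite_subset)
  then have "finite ((\<lambda>x. center G #> x) ` carrier G)"
  proof (rule finite_image_factor)
    fix x y assume x: "x \<in> carrier G" and y: "y \<in> carrier G" and eq: "f x = f y"
    let ?z = "inv y \<otimes> x"
    have z: "?z \<in> carrier G" using x y by simp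
    have "?z \<otimes> s = s \<otimes> ?z" if "s \<in> S" for s
    proof -
      have s: "s \<in> carrier G" using that S by auto
      have "x \<otimes> s \<otimes> inv x = y \<otimes> s \<otimes> inv y"
        using fun_cong[OF eq, of s] that by (simp add: f_def)
      then have "inv y \<otimes> (x \<otimes> s \<otimes> inv x) \<otimes> x = inv y \<otimes> (y \<otimes> s \<otimes> inv y) \<otimes> x" by simp
      then show ?thesis using x y s by (simp add: m_assoc mult_inv_cancel)
    qed
    then have "?z \<otimes> g = g \<otimes> ?z" if "g \<in> carrier G" for g
      using commutes_generate[OF z S(2), of g] that S(3) by auto
    then have zc: "?z \<in> center G" using z by (simp add: center_def)
    have "x = ?z \<otimes> y" using centerD[OF zc y] x y by (simp add: mult_inv_cancel)
    then have "x \<otimes> inv y = ?z" using x y by (simp add: inv_solve_right')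
    then show "center G #> x = center G #> y"
      using zc rcos_eq_iff[OF center_subgroup x y] by simp
  qed
  then show ?thesis by (simp add: rcosets_image)
qed

text \<open>Conjugation by \<open>g\<close> depends only on the coset of \<open>g\<close> modulo the
  centre.\<close>

lemma (in group) FC_group_if_center_finite_index:
  assumes "finite (rcosets (center G))"
  shows "FC_group G"
  unfolding FC_group_def
proof
  fix x assume x: "x \<in> carrier G"
  have "finite ((\<lambda>g. center G #> g) ` carrier G)"
    using assms by (simp add: rcosets_image)
  then have "finite ((\<lambda>g. g \<otimes> x \<otimes> inv g) ` carrier G)"
  proof (rule finite_image_factor)
    fix g h assume g: "g \<in> carrier G" and h: "h \<in> carrier G" and "center G #> g = center G #> h"
    then have z: "g \<otimes> inv h \<in> center G" using rcos_eq_iff[OF center_subgroup g h] by simp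
    let ?z = "g \<otimes> inv h" and ?w = "h \<otimes> x \<otimes> inv h"
    have "g \<otimes> x \<otimes> inv g = ?z \<otimes> ?w \<otimes> inv ?z"
      using g h x by (simp add: m_assoc mult_inv_cancel inv_mult_group)
    also have "?z \<otimes> ?w = ?w \<otimes> ?z" using centerD[OF z] g h x by simp
    also have "?w \<otimes> ?z \<otimes> inv ?z = ?w"
      using g h x by (simp add: m_assoc mult_inv_cancel inv_mult_group)
    finally show "g \<otimes> x \<otimes> inv g = h \<otimes> x \<otimes> inv h" .
  qed
  then show "finite {g \<otimes> x \<otimes> inv g | g. g \<in> carrier G}"
    by (simp add: setcompr_eq_image)
qed

text \<open>Makes the comparison of two cosets a question about one word, the form in which
  noncentrality is transferred.\<close>

lemma (in group) word_value_center_iff: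
  assumes "set gs \<subseteq> carrier G" "u \<in> words (length gs)" "v \<in> words (length gs)"
  shows "word_value G gs (u @ inverse_word v) \<in> center G \<longleftrightarrow>
    center G #> word_value G gs u = center G #> word_value G gs v"
  using assms rcos_eq_iff[OF center_subgroup, of "word_value G gs u" "word_value G gs v"]
  by (simp add: word_value_append word_value_inverse word_value_closed)

lemma (in group) rcosets_representing_words:
  assumes "generating_sequence G gs"
  obtains R where "\<And>C. C \<in> rcosets K \<Longrightarrow> R C \<in> words (length gs)"
    "\<And>C. C \<in> rcosets K \<Longrightarrow> K #> word_value G gs (R C) = C"
proof -
  have "\<exists>w\<in>words (length gs). K #> word_value G gs w = C" if "C \<in> rcosets K" for C
  proof -
    obtain x where "x \<in> carrier G" "C = K #> x" using \<open>C \<in> rcosets K\<close> by (auto simp: rcosets_image)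
    then show ?thesis using word_value_surj[OF assms] by metis
  qed
  then show ?thesis using that by metis
qed

lemma (in group) finitely_generated_sequence:
  assumes "finitely_generated_group G"
  obtains gs where "generating_sequence G gs"
  using assms finite_list unfolding finitely_generated_group_def generating_sequence_def by metis

text \<open>With \<open>N\<close> the whole group the coset colour carries no information; this is
  the choice of \<open>N\<close> when only inequations are to be transferred.\<close>

lemma (in group) carrier_normal: "carrier G \<lhd> G"
  by (auto simp: normal_inv_iff subgroup_self)

lemma (in group) carrier_finite_index: "finite (rcosets (carrier G))"
  using coset_join2[OF _ subgroup_self] by (auto simp: rcosets_image image_constant_conv)

text \<open>The transfer runs from \<open>H\<close> to \<open>G\<close>: words separating cosets of
  Z(H) are noncentral in \<open>H\<close> and stay noncentral in \<open>G\<close>, so they separate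
  cosets of Z(G). Only finitely many words can be handled and the index in \<open>H\<close> may a
  priori be infinite; hence the uniform bound on finite sets \<open>F\<close> of cosets.\<close>

lemma center_index_le:
  fixes G :: "('a, 'm) monoid_scheme" and H :: "('b, 'n) monoid_scheme"
  assumes "group G" "group H" "Con_group G = Con_group H"
    and "finitely_generated_group H" and fin: "finite (rcosets\<^bsub>G\<^esub> (center G))"
  shows "finite (rcosets\<^bsub>H\<^esub> (center H)) \<and>
    card (rcosets\<^bsub>H\<^esub> (center H)) \<le> card (rcosets\<^bsub>G\<^esub> (center G))"
proof (rule finite_if_finite_subsets_card_bdd)
  interpret G: group G by fact
  interpret H: group H by fact
  obtain hs where hs: "generating_sequence H hs"
    using H.finitely_generated_sequence[OF assms(4)] .
  have hsH: "set hs \<subseteq> carrier H" using hs by (rule H.generating_sequenceD)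
  obtain R where R: "\<And>C. C \<in> rcosets\<^bsub>H\<^esub> (center H) \<Longrightarrow> R C \<in> words (length hs)"
    "\<And>C. C \<in> rcosets\<^bsub>H\<^esub> (center H) \<Longrightarrow> center H #>\<^bsub>H\<^esub> word_value H hs (R C) = C"
    by (rule H.rcosets_representing_words[OF hs, of "center H"]) (rule that)
  fix F assume F: "F \<subseteq> rcosets\<^bsub>H\<^esub> (center H)" "finite F"
  let ?U = "(\<lambda>(C, D). R C @ inverse_word (R D)) ` (F \<times> F)"
  have U: "finite ?U" "?U \<subseteq> words (length hs)" using F R(1) by (auto simp: subset_iff)
  obtain gs where gs: "generating_sequence G gs" and len: "length gs = length hs"
    and nc: "\<And>u. u \<in> ?U \<Longrightarrow> word_value H hs u \<notin> center H \<Longrightarrow> word_value G gs u \<notin> center G"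
    by (rule word_transfer[OF assms(2,1) assms(3)[symmetric] hs
        H.carrier_normal H.carrier_finite_index U]) (rule that)
  have gsG: "set gs \<subseteq> carrier G" using gs by (rule G.generating_sequenceD)
  let ?f = "\<lambda>C. center G #>\<^bsub>G\<^esub> word_value G gs (R C)"
  have "inj_on ?f F"
  proof (rule inj_onI, rule ccontr)
    fix C D assume CD: "C \<in> F" "D \<in> F" "?f C = ?f D" "C \<noteq> D"
    have w: "R C \<in> words (length hs)" "R D \<in> words (length hs)" using CD F R(1) by auto
    have "word_value H hs (R C @ inverse_word (R D)) \<notin> center H"
      using CD F R(2) unfolding H.word_value_center_iff[OF hsH w] by (metis subsetD)
    then have "word_value G gs (R C @ inverse_word (R D)) \<notin> center G"
      by (rule nc[rotated]) (use CD in auto)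
    then show False
      using G.word_value_center_iff[OF gsG, of "R C" "R D"] w len CD by simp
  qed
  moreover have "?f ` F \<subseteq> rcosets\<^bsub>G\<^esub> (center G)"
    using F R(1) len by (auto simp: G.rcosets_image intro!: imageI G.word_value_closed gsG)
  ultimately show "card F \<le> card (rcosets\<^bsub>G\<^esub> (center G))"
    using fin by (rule card_inj_on_le)
qed

text \<open>
  Only inequations between cosets are transferred, but as both central quotients have the same
  order, a coset that differs from all representatives but one must equal the remaining one.
\<close>

lemma central_words_transfer:
  fixes G :: "('a, 'm) monoid_scheme" and H :: "('b, 'n) monoid_scheme"
  assumes "group G" "group H" "Con_group G = Con_group H"
    and gs: "generating_sequence G gs"
    and fin: "finite (rcosets\<^bsub>G\<^esub> (center G))" "finite (rcosets\<^bsub>H\<^esub> (center H))"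
    and card: "card (rcosets\<^bsub>H\<^esub> (center H)) = card (rcosets\<^bsub>G\<^esub> (center G))"
    and "N \<lhd> G" and finN: "finite (rcosets\<^bsub>G\<^esub> N)"
  obtains hs where "generating_sequence H hs" "length hs = length gs"
    "\<And>w. w \<in> words (length gs) \<Longrightarrow>
      word_value G gs w \<in> center G \<longleftrightarrow> word_value H hs w \<in> center H"
    "\<And>w. w \<in> words (length gs) \<Longrightarrow> word_value H hs w = \<one>\<^bsub>H\<^esub> \<Longrightarrow> word_value G gs w \<in> N"
proof -
  interpret G: group G by fact
  interpret H: group H by fact
  let ?n = "length gs" and ?Q = "rcosets\<^bsub>G\<^esub> (center G)"
  have gsG: "set gs \<subseteq> carrier G" using gs by (rule G.generating_sequenceD)
  obtain R where R: "\<And>C. C \<in> ?Q \<Longrightarrow> R C \<in> words ?n"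
    "\<And>C. C \<in> ?Q \<Longrightarrow> center G #>\<^bsub>G\<^esub> word_value G gs (R C) = C"
    by (rule G.rcosets_representing_words[OF gs, of "center G"]) (rule that)
  let ?L = "UNIV \<times> {..<?n}"
  \<comment> \<open>The empty word, representatives, and letters prefixed to representatives: the
    only words that have to be compared for an induction over all words.\<close>
  define P where "P = insert [] (R ` ?Q \<union> (\<lambda>(a, C). a # R C) ` (?L \<times> ?Q))"
  define U where "U = (\<lambda>(u, C). u @ inverse_word (R C)) ` (P \<times> ?Q)"
  have P: "P \<subseteq> words ?n" using R(1) by (auto simp: P_def)
  have U: "finite U" "U \<subseteq> words ?n" using P R(1) fin by (auto simp: U_def P_def)
  obtain hs where hs: "generating_sequence H hs" and len: "length hs = ?n"
    and nc: "\<And>u. u \<in> U \<Longrightarrow> word_value G gs u \<notin> center G \<Longrightarrow> word_value H hs u \<notin> center H"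
    and N: "\<And>w. w \<in> words ?n \<Longrightarrow> word_value H hs w = \<one>\<^bsub>H\<^esub> \<Longrightarrow> word_value G gs w \<in> N"
    by (rule word_transfer[OF assms(1-4) \<open>N \<lhd> G\<close> finN U]) (rule that)
  have hsH: "set hs \<subseteq> carrier H" using hs by (rule H.generating_sequenceD)
  define p where "p w = center G #>\<^bsub>G\<^esub> word_value G gs w" for w
  define q where "q w = center H #>\<^bsub>H\<^esub> word_value H hs w" for w
  have pQ: "p w \<in> ?Q" if "w \<in> words ?n" for w
    using G.word_value_closed[OF gsG that] by (auto simp: p_def G.rcosets_image)
  have qQ: "q w \<in> rcosets\<^bsub>H\<^esub> (center H)" if "w \<in> words ?n" for w
    using H.word_value_closed[OF hsH] that len by (auto simp: q_def H.rcosets_image)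
  have pR: "p (R C) = C" if "C \<in> ?Q" for C using R(2)[OF that] by (simp add: p_def)
  have sep: "p u = C" if "u \<in> P" "C \<in> ?Q" "q u = q (R C)" for u C
  proof (rule ccontr)
    assume "p u \<noteq> C"
    have w: "u \<in> words ?n" "R C \<in> words ?n" using that P R(1) by auto
    have "word_value G gs (u @ inverse_word (R C)) \<notin> center G"
      using \<open>p u \<noteq> C\<close> pR[OF that(2)] unfolding G.word_value_center_iff[OF gsG w] p_def by simp
    moreover have "u @ inverse_word (R C) \<in> U" using that by (auto simp: U_def)
    ultimately have "word_value H hs (u @ inverse_word (R C)) \<notin> center H" by (rule nc[rotated])
    then show False
      using H.word_value_center_iff[OF hsH, of u "R C"] w len that(3) by (simp add: q_def)
  qed
  have inj: "inj_on (\<lambda>C. q (R C)) ?Q"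
  proof (rule inj_onI)
    fix C D assume "C \<in> ?Q" "D \<in> ?Q" "q (R C) = q (R D)"
    then show "C = D" using sep[of "R C" D] pR by (auto simp: P_def)
  qed
  have "(\<lambda>C. q (R C)) ` ?Q = rcosets\<^bsub>H\<^esub> (center H)"
  proof (rule card_subset_eq[OF fin(2)])
    show "(\<lambda>C. q (R C)) ` ?Q \<subseteq> rcosets\<^bsub>H\<^esub> (center H)" using R(1) qQ by auto
  qed (simp add: card_image[OF inj] card)
  then have qP: "q u = q (R (p u))" if "u \<in> P" for u
    using sep[OF that] qQ[of u] P that by (metis (no_types, lifting) imageE subsetD)
  \<comment> \<open>The coset in \<open>H\<close> is a function of the coset in \<open>G\<close>.
    The induction replaces the tail by its representative before the letter is prefixed, so the
    resulting word lies in the finite set \<open>P\<close>.\<close>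
  have q: "q w = q (R (p w))" if "w \<in> words ?n" for w
    using that
  proof (induction w)
    case Nil
    show ?case by (rule qP) (simp add: P_def)
  next
    case (Cons a w)
    then have a: "snd a < ?n" and w: "w \<in> words ?n" by auto
    have Rw: "R (p w) \<in> words ?n" using R(1) pQ w by auto
    have c: "letter_value G gs a \<in> carrier G" "letter_value H hs a \<in> carrier H"
      "word_value G gs w \<in> carrier G" "word_value H hs w \<in> carrier H"
      "word_value G gs (R (p w)) \<in> carrier G" "word_value H hs (R (p w)) \<in> carrier H"
      using a w Rw len gsG hsH
      by (auto intro!: G.letter_value_closed H.letter_value_closed G.word_value_closed H.word_value_closed)
    have "q (a # w) = q (a # R (p w))"
      using normal.rcos_mult_cong[OF H.normal_central_subgroup[OF H.center_subgroup subset_refl] c(4,6,2)] Cons.IH[OF w]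
      by (simp add: q_def)
    also have "\<dots> = q (R (p (a # R (p w))))"
      using a pQ[OF w] by (intro qP) (cases a, auto simp: P_def)
    also have "p (a # R (p w)) = p (a # w)"
      using normal.rcos_mult_cong[OF G.normal_central_subgroup[OF G.center_subgroup subset_refl] c(5,3,1)] pR[OF pQ[OF w]]
      by (simp add: p_def)
    finally show ?case .
  qed
  have "word_value G gs w \<in> center G \<longleftrightarrow> word_value H hs w \<in> center H" if w: "w \<in> words ?n" for w
  proof -
    have "q w = q [] \<longleftrightarrow> p w = p []"
      using q[OF w] q[of "[]"] inj pQ[OF w] pQ[of "[]"] by (auto dest: inj_onD)
    moreover have "q w = q [] \<longleftrightarrow> word_value H hs w \<in> center H"
      using H.word_value_center_iff[OF hsH, of w "[]"] w len by (simp add: q_def inverse_word_def)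
    moreover have "p w = p [] \<longleftrightarrow> word_value G gs w \<in> center G"
      using G.word_value_center_iff[OF gsG, of w "[]"] w by (simp add: p_def inverse_word_def)
    ultimately show ?thesis by simp
  qed
  then show ?thesis using that[OF hs len _ N] by blast
qed

section \<open>Finitely generated abelian groups\<close>

text \<open>Recursion is over the generators and \<open>hd\<close>, \<open>tl\<close> read off the
  coefficients; only coefficient lists of the same length are meant.\<close>

primrec int_comb :: "('a, 'm) monoid_scheme \<Rightarrow> 'a list \<Rightarrow> int list \<Rightarrow> 'a" where
  "int_comb G [] cs = \<one>\<^bsub>G\<^esub>"
| "int_comb G (x # xs) cs = x [^]\<^bsub>G\<^esub> hd cs \<otimes>\<^bsub>G\<^esub> int_comb G xs (tl cs)"

definition int_span :: "('a, 'm) monoid_scheme \<Rightarrow> 'a list \<Rightarrow> 'a set" where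
  "int_span G xs = int_comb G xs ` {cs. length cs = length xs}"

lemma int_spanI: "length cs = length xs \<Longrightarrow> int_comb G xs cs \<in> int_span G xs"
  by (auto simp: int_span_def)

lemma int_spanE:
  assumes "v \<in> int_span G xs"
  obtains cs where "length cs = length xs" "v = int_comb G xs cs"
  using assms by (auto simp: int_span_def)

context comm_group
begin

lemma int_comb_closed: "set xs \<subseteq> carrier G \<Longrightarrow> int_comb G xs cs \<in> carrier G"
  by (induction xs arbitrary: cs) auto

lemma int_comb_add:
  assumes "set xs \<subseteq> carrier G" "length cs = length xs" "length ds = length xs"
  shows "int_comb G xs (map2 (+) cs ds) = int_comb G xs cs \<otimes> int_comb G xs ds"
  using assms(2) assms(3)[symmetric] assms(1)
proof (induction cs xs ds rule: list_induct3)
  case (Cons c cs x xs d ds)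
  then show ?case
    by (simp add: int_comb_closed int_pow_mult m_ac)
qed simp

lemma int_comb_scale:
  assumes "set xs \<subseteq> carrier G" "length cs = length xs"
  shows "int_comb G xs (map ((*) n) cs) = int_comb G xs cs [^] n"
  using assms(2,1)
proof (induction cs xs rule: list_induct2)
  case (Cons c cs x xs)
  then show ?case
    by (simp add: int_comb_closed int_pow_pow int_pow_distrib mult.commute)
qed simp

lemma int_comb_zero: "int_comb G xs (replicate (length xs) 0) = \<one>" if "set xs \<subseteq> carrier G"
  using that by (induction xs) auto

lemma int_comb_diff:
  assumes "set xs \<subseteq> carrier G" "length cs = length xs" "length ds = length xs"
  shows "int_comb G xs (map2 (-) cs ds) = int_comb G xs cs \<otimes> inv (int_comb G xs ds)"
proof -
  have "map2 (-) cs ds = map2 (+) cs (map ((*) (- 1)) ds)"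
    by (auto simp: list_eq_iff_nth_eq)
  then show ?thesis
    using assms int_comb_add[of xs cs "map ((*) (- 1)) ds"] int_comb_scale[of xs ds "- 1"]
    by (simp add: int_comb_closed int_pow_neg)
qed

lemma int_comb_eq_iff:
  assumes "set xs \<subseteq> carrier G" "length cs = length xs" "length ds = length xs"
  shows "int_comb G xs cs = int_comb G xs ds \<longleftrightarrow> int_comb G xs (map2 (-) cs ds) = \<one>"
  unfolding int_comb_diff[OF assms]
  using inv_solve_right'[of "\<one>" "int_comb G xs cs" "int_comb G xs ds"] assms
  by (simp add: int_comb_closed)

text \<open>Commutativity lets two generators change places together with their coefficients. Thus
  any coefficient of a relation can be brought to the head.\<close>

lemma int_comb_swap:
  assumes "set (y # ys) \<subseteq> carrier G" "length cs = length ys" "i < length ys"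
  shows "int_comb G (ys ! i # ys[i := y]) (cs ! i # cs[i := c]) = int_comb G (y # ys) (c # cs)"
  using assms(2,1,3)
proof (induction cs ys arbitrary: i rule: list_induct2)
  case (Cons d cs x ys)
  show ?case
  proof (cases i)
    case 0
    then show ?thesis using Cons.prems by (simp add: int_comb_closed m_lcomm)
  next
    case (Suc j)
    have "ys ! j \<in> carrier G" "set (ys[j := y]) \<subseteq> carrier G"
      using Cons.prems Suc set_update_subset_insert[of ys j y] by auto
    then show ?thesis
      using Cons.IH[of j] Cons.prems Suc
      by (simp add: int_comb_closed m_lcomm[of "ys ! j [^] _"] m_lcomm[of "y [^] _" "x [^] _"])
  qed
qed simp

lemma int_span_swap_subset:
  assumes "set (y # ys) \<subseteq> carrier G" "i < length ys"
  shows "int_span G (y # ys) \<subseteq> int_span G (ys ! i # ys[i := y])"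
proof
  fix v assume "v \<in> int_span G (y # ys)"
  then obtain c cs where cs: "length cs = length ys" "v = int_comb G (y # ys) (c # cs)"
    by (auto simp: int_span_def length_Suc_conv)
  then have "v = int_comb G (ys ! i # ys[i := y]) (cs ! i # cs[i := c])"
    using int_comb_swap assms by metis
  also have "\<dots> \<in> int_span G (ys ! i # ys[i := y])" using cs(1) by (intro int_spanI) simp
  finally show "v \<in> int_span G (ys ! i # ys[i := y])" .
qed

lemma int_span_swap:
  assumes "set (y # ys) \<subseteq> carrier G" "i < length ys"
  shows "int_span G (ys ! i # ys[i := y]) = int_span G (y # ys)"
proof (rule antisym)
  have "ys ! i \<in> carrier G" "set (ys[i := y]) \<subseteq> carrier G"
    using assms set_update_subset_insert[of ys i y] by auto
  then show "int_span G (ys ! i # ys[i := y]) \<subseteq> int_span G (y # ys)"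
    using int_span_swap_subset[of "ys ! i" "ys[i := y]" i] assms(2) by simp
qed (rule int_span_swap_subset[OF assms])

text \<open>The elementary operation behind division with remainder: with quotients as
  \<open>qs\<close>, multiples of \<open>d\<close> in the tail are absorbed into the head generator
  and remainders stay behind.\<close>

lemma int_comb_shift:
  assumes "set (y # ys) \<subseteq> carrier G" "length qs = length ys" "length cs = length ys"
  shows "int_comb G (y \<otimes> int_comb G ys qs # ys) (d # cs)
    = int_comb G (y # ys) (d # map2 (+) (map ((*) d) qs) cs)"
  using assms
  by (simp add: int_comb_add int_comb_scale int_comb_closed int_pow_distrib m_assoc)

lemma int_span_shift:
  assumes "set (y # ys) \<subseteq> carrier G" "length qs = length ys"
  shows "int_span G (y \<otimes> int_comb G ys qs # ys) = int_span G (y # ys)"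
proof (rule antisym; rule subsetI)
  fix v assume "v \<in> int_span G (y \<otimes> int_comb G ys qs # ys)"
  then obtain d cs where "length cs = length ys"
      "v = int_comb G (y \<otimes> int_comb G ys qs # ys) (d # cs)"
    by (auto simp: int_span_def length_Suc_conv)
  then show "v \<in> int_span G (y # ys)"
    using int_comb_shift[OF assms] assms(2) by (metis int_spanI length_Cons length_map map_snd_zip)
next
  fix v assume "v \<in> int_span G (y # ys)"
  then obtain d cs where cs: "length cs = length ys" "v = int_comb G (y # ys) (d # cs)"
    by (auto simp: int_span_def length_Suc_conv)
  let ?cs = "map2 (-) cs (map ((*) d) qs)"
  have "map2 (+) (map ((*) d) qs) ?cs = cs"
    using cs(1) assms(2) by (auto simp: list_eq_iff_nth_eq)
  then have "v = int_comb G (y \<otimes> int_comb G ys qs # ys) (d # ?cs)"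
    using int_comb_shift[OF assms, of ?cs d] cs assms(2) by simp
  also have "\<dots> \<in> int_span G (y \<otimes> int_comb G ys qs # ys)"
    using cs(1) assms(2) by (intro int_spanI) simp
  finally show "v \<in> int_span G (y \<otimes> int_comb G ys qs # ys)" .
qed

lemma int_span_Cons: "int_span G (y # ys) = {y [^] (c :: int) \<otimes> v | c v. v \<in> int_span G ys}"
proof (rule antisym; rule subsetI)
  fix v assume "v \<in> int_span G (y # ys)"
  then obtain cs where cs: "length cs = Suc (length ys)" "v = int_comb G (y # ys) cs"
    by (auto elim: int_spanE)
  then have "int_comb G ys (tl cs) \<in> int_span G ys" by (intro int_spanI) simp
  then show "v \<in> {y [^] (c :: int) \<otimes> v | c v. v \<in> int_span G ys}" using cs(2) by auto
next
  fix v assume "v \<in> {y [^] (c :: int) \<otimes> v | c v. v \<in> int_span G ys}"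
  then obtain c u where v: "v = y [^] (c :: int) \<otimes> u" "u \<in> int_span G ys" by blast
  from v(2) obtain cs where "length cs = length ys" "u = int_comb G ys cs" by (rule int_spanE)
  with v(1) have "v = int_comb G (y # ys) (c # cs)" "length (c # cs) = length (y # ys)" by auto
  then show "v \<in> int_span G (y # ys)" by (metis int_spanI)
qed

text \<open>
  Among all relations of generating \<open>k\<close>-tuples a smallest positive coefficient \<open>d\<close> divides every
  other coefficient, as otherwise division with remainder would give a smaller one; hence some
  generator of order \<open>d\<close> splits off.
\<close>

lemma adapted_generators:
  assumes "set xs \<subseteq> carrier G"
  shows "\<exists>ys ds. length ys = length xs \<and> length ds = length xs \<and> set ys \<subseteq> carrier G \<and>
    int_span G ys = int_span G xs \<and> (\<forall>d\<in>set ds. 0 \<le> d) \<and> sorted_wrt (dvd) ds \<and>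
    (\<forall>cs. length cs = length xs \<longrightarrow> (int_comb G ys cs = \<one> \<longleftrightarrow> list_all2 (dvd) ds cs))"
  using assms
proof (induction "length xs" arbitrary: xs)
  case 0
  then show ?case by (intro exI[of _ "[]"]) auto
next
  case (Suc k)
  \<comment> \<open>\<open>T\<close> is closed under exchanging the head with another generator and
    under multiplying the head by a combination of the others.\<close>
  define T where "T = {ys. length ys = Suc k \<and> set ys \<subseteq> carrier G \<and> int_span G ys = int_span G xs}"
  \<comment> \<open>Recording positive head coefficients is enough: an exchange brings any
    coefficient to the head, and inverting the relation changes its sign.\<close>
  define Rel where "Rel d \<longleftrightarrow> 0 < d \<and> (\<exists>y ys cs. y # ys \<in> T \<and> length cs = k \<and>
      int_comb G (y # ys) (int d # cs) = \<one>)" for d :: nat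
  have T_D: "set ys \<subseteq> carrier G" "length ys = Suc k" if "ys \<in> T" for ys
    using that by (auto simp: T_def)
  have head: "Rel (nat \<bar>c\<bar>)"
    if T: "y # ys \<in> T" and cs: "length cs = k" "int_comb G (y # ys) (c # cs) = \<one>" and "c \<noteq> 0" for y ys c cs
  proof (cases "c > 0")
    case True
    then show ?thesis using that by (auto simp: Rel_def)
  next
    case False
    have "int_comb G (y # ys) (map ((*) (- 1)) (c # cs)) = \<one>"
      using int_comb_scale[of "y # ys" "c # cs" "- 1"] T_D[OF T] cs by simp
    then have "int_comb G (y # ys) (int (nat \<bar>c\<bar>) # map ((*) (- 1)) cs) = \<one>"
      using False by simp
    moreover have "0 < nat \<bar>c\<bar>" "length (map ((*) (- 1)) cs) = k" using \<open>c \<noteq> 0\<close> cs by auto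
    ultimately show ?thesis unfolding Rel_def using T by blast
  qed
  have tail: "Rel (nat \<bar>c'\<bar>)"
    if T: "y # ys \<in> T" and cs: "length cs = k" "int_comb G (y # ys) (c # cs) = \<one>"
      and c': "c' \<in> set cs" "c' \<noteq> 0" for y ys c cs c'
  proof -
    obtain i where i: "i < k" "c' = cs ! i" using c' cs by (metis in_set_conv_nth)
    have yys: "set (y # ys) \<subseteq> carrier G" "length ys = k" using T_D[OF T] by auto
    have "set (ys ! i # ys[i := y]) \<subseteq> carrier G"
      using yys i set_update_subset_insert[of ys i y] by auto
    then have "ys ! i # ys[i := y] \<in> T"
      using T yys i int_span_swap[OF yys(1), of i] by (simp add: T_def)
    moreover have "int_comb G (ys ! i # ys[i := y]) (c' # cs[i := c]) = \<one>"
      using int_comb_swap[OF yys(1), of cs i c] cs yys i by simp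
    ultimately show ?thesis using head[of "ys ! i" "ys[i := y]" "cs[i := c]" c'] cs c' by simp
  qed
  have xsT: "xs \<in> T" using Suc by (simp add: T_def)
  show ?case
  proof (cases "\<exists>d. Rel d")
    case False
    \<comment> \<open>Without relations the generators are free. Zero encodes infinite order, as
      \<open>0 dvd c\<close> means \<open>c = 0\<close>.\<close>
    let ?ds = "replicate (Suc k) (0 :: int)"
    have "int_comb G xs cs = \<one> \<longleftrightarrow> list_all2 (dvd) ?ds cs" if l: "length cs = Suc k" for cs
    proof
      assume rel: "int_comb G xs cs = \<one>"
      obtain y ys where xs: "xs = y # ys" using Suc.hyps(2) by (cases xs) auto
      obtain c cs' where cs: "cs = c # cs'" "length cs' = k" using l by (cases cs) auto
      have "c = 0"
        using head[of y ys cs' c] xsT rel False cs(2) unfolding xs cs(1) by blast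
      moreover have "c' = 0" if "c' \<in> set cs'" for c'
        using tail[of y ys cs' c c'] xsT rel False cs(2) that unfolding xs cs(1) by blast
      ultimately have "\<forall>c'\<in>set cs. c' = 0" by (simp add: cs(1))
      then show "list_all2 (dvd) ?ds cs" using l by (auto simp: list_all2_conv_all_nth simp del: replicate.simps)
    next
      assume "list_all2 (dvd) ?ds cs"
      then have "cs = replicate (length xs) 0"
        using l Suc.hyps(2)[symmetric]
        by (auto simp: list_all2_conv_all_nth list_eq_iff_nth_eq simp del: replicate.simps)
      then show "int_comb G xs cs = \<one>" using int_comb_zero Suc.prems by simp
    qed
    moreover have "sorted_wrt (dvd) ?ds" by (simp add: sorted_wrt_iff_nth_less)
    ultimately show ?thesis
      using Suc.prems Suc.hyps(2)[symmetric] by (intro exI[of _ xs] exI[of _ ?ds]) auto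
  next
    case True
    define d where "d = (LEAST d. Rel d)"
    have d: "Rel d" unfolding d_def using True by (rule LeastI_ex)
    have least: "d \<le> d'" if "Rel d'" for d' unfolding d_def by (rule Least_le[of Rel, OF that])
    have dpos: "0 < d" using d by (simp add: Rel_def)
    have small: "c = 0" if "\<not> Rel (nat \<bar>c\<bar>) \<longrightarrow> c = 0" "0 \<le> c" "c < int d" for c
      using least[of "nat \<bar>c\<bar>"] that by linarith
    \<comment> \<open>Absorbing the quotients modulo \<open>d\<close> into the head leaves a
      relation with coefficients \<open>d\<close> and the remainders. By minimality the remainders
      vanish, so the \<open>d\<close>-th power of the new head is trivial.\<close>
    have split: "y \<otimes> int_comb G ys (map (\<lambda>c. c div int d) cs) # ys \<in> T \<and>
        (\<forall>c\<in>set cs. int d dvd c) \<and>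
        (y \<otimes> int_comb G ys (map (\<lambda>c. c div int d) cs)) [^] int d = \<one>"
      if T: "y # ys \<in> T" and cs: "length cs = k" "int_comb G (y # ys) (int d # cs) = \<one>" for y ys cs
    proof -
      let ?qs = "map (\<lambda>c. c div int d) cs" and ?rs = "map (\<lambda>c. c mod int d) cs"
      let ?y = "y \<otimes> int_comb G ys ?qs"
      have yys: "set (y # ys) \<subseteq> carrier G" "length ys = k" using T_D[OF T] by auto
      have "?y \<in> carrier G" using yys by (simp add: int_comb_closed)
      have T': "?y # ys \<in> T"
        using T yys int_span_shift[of y ys ?qs] cs \<open>?y \<in> carrier G\<close> by (simp add: T_def)
      have "map2 (+) (map ((*) (int d)) ?qs) ?rs = cs"
        by (auto simp: list_eq_iff_nth_eq)
      then have rel: "int_comb G (?y # ys) (int d # ?rs) = \<one>"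
        using int_comb_shift[OF yys(1), of ?qs ?rs "int d"] cs yys by simp
      have r0: "c mod int d = 0" if "c \<in> set cs" for c
      proof (rule small)
        show "\<not> Rel (nat \<bar>c mod int d\<bar>) \<longrightarrow> c mod int d = 0"
          using tail[OF T' _ rel, of "c mod int d"] cs that by auto
      qed (use dpos in auto)
      then have "?rs = replicate k 0" using cs(1) by (auto simp: list_eq_iff_nth_eq)
      then have "?y [^] int d = \<one>"
        using rel int_comb_zero[of ys] yys \<open>?y \<in> carrier G\<close> by simp
      then show ?thesis using T' r0 by auto
    qed
    obtain y0 ys cs0 where "y0 # ys \<in> T" "length cs0 = k" "int_comb G (y0 # ys) (int d # cs0) = \<one>"
      using d by (auto simp: Rel_def)
    from split[OF this] obtain y where yT: "y # ys \<in> T" and yd: "y [^] int d = \<one>" by blast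
    have y: "y \<in> carrier G" and ys: "set ys \<subseteq> carrier G" "length ys = k" using T_D[OF yT] by auto
    obtain zs ds where zs: "length zs = k" "length ds = k" "set zs \<subseteq> carrier G"
        "int_span G zs = int_span G ys" "\<forall>d\<in>set ds. 0 \<le> d" "sorted_wrt (dvd) ds"
      and rel_zs: "\<And>cs. length cs = k \<Longrightarrow> int_comb G zs cs = \<one> \<longleftrightarrow> list_all2 (dvd) ds cs"
      using Suc.hyps(1)[of ys] ys by auto
    have span: "int_span G (y # zs) = int_span G xs"
      using yT zs(4) by (simp add: T_def int_span_Cons)
    then have zT: "y # zs \<in> T" using y zs by (simp add: T_def)
    have y_dvd: "y [^] e = \<one>" if "int d dvd e" for e
    proof -
      from that obtain m where "e = int d * m" ..
      then have "y [^] e = (y [^] int d) [^] m" using y by (simp only: int_pow_pow)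
      then show ?thesis by (simp only: yd int_pow_one)
    qed
    \<comment> \<open>The sum is direct: as the \<open>d\<close>-th power of \<open>y\<close> is
      trivial, the head coefficient may be reduced modulo \<open>d\<close> inside the relation, and
      minimality leaves no remainder.\<close>
    have rel: "int d dvd e \<and> int_comb G zs es = \<one>"
      if es: "length es = k" "int_comb G (y # zs) (e # es) = \<one>" for e es
    proof -
      have e: "e = int d * (e div int d) + e mod int d" by simp
      have "y [^] e = y [^] (int d * (e div int d)) \<otimes> y [^] (e mod int d)"
        using y by (subst e) (simp only: int_pow_mult)
      also have "y [^] (int d * (e div int d)) = \<one>" by (rule y_dvd) simp
      finally have "y [^] e = y [^] (e mod int d)" using y by simp
      then have "int_comb G (y # zs) (e mod int d # es) = \<one>" using es by simp
      then have "e mod int d = 0"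
        using head[OF zT es(1)] small[of "e mod int d"] dpos by fastforce
      then have "int d dvd e" by auto
      then show ?thesis using es y_dvd[of e] zs int_comb_closed[of zs es] by simp
    qed
    have d_dvd: "int d dvd e" if "e \<in> set ds" for e
    proof -
      obtain i where i: "i < k" "e = ds ! i" using \<open>e \<in> set ds\<close> zs by (metis in_set_conv_nth)
      \<comment> \<open>The relation of \<open>y\<close> and the relation with exponent
        \<open>e\<close> of the single generator \<open>zs ! i\<close> are joined into one with head
        \<open>d\<close>; then \<open>split\<close> forces \<open>d\<close> to divide
        \<open>e\<close>.\<close>
      let ?es = "(replicate k 0)[i := e]"
      have "list_all2 (dvd) ds ?es"
        using zs i by (auto simp: list_all2_conv_all_nth nth_list_update)
      then have "int_comb G zs ?es = \<one>" using rel_zs by simp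
      then have "int_comb G (y # zs) (int d # ?es) = \<one>" using yd by simp
      then have "\<forall>c\<in>set ?es. int d dvd c" using split[OF zT, of ?es] by simp
      moreover have "e \<in> set ?es" using i by (intro set_update_memI) simp
      ultimately show ?thesis by blast
    qed
    have "int_comb G (y # zs) cs = \<one> \<longleftrightarrow> list_all2 (dvd) (int d # ds) cs" if l: "length cs = Suc k" for cs
    proof -
      obtain e es where cs: "cs = e # es" "length es = k" using l by (cases cs) auto
      show ?thesis
        using rel[OF cs(2), of e] rel_zs[OF cs(2)] y_dvd[of e] unfolding cs(1) by auto
    qed
    moreover have "sorted_wrt (dvd) (int d # ds)" using d_dvd zs by simp
    ultimately show ?thesis
      using y zs span Suc.hyps(2)[symmetric]
      by (intro exI[of _ "y # zs"] exI[of _ "int d # ds"]) auto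
  qed
qed

end

text \<open>The base set is an argument of its own, so that the n-th powers of the centre can be
  taken in \<open>G\<close> as well as in the centre itself.\<close>

definition power_subgroup :: "('a, 'm) monoid_scheme \<Rightarrow> 'a set \<Rightarrow> nat \<Rightarrow> 'a set" where
  "power_subgroup G K n = (\<lambda>x. x [^]\<^bsub>G\<^esub> n) ` K"

text \<open>The boxes will list coset representatives. A zero entry makes the box empty and the
  product zero.\<close>

lemma finite_card_boxes: "finite {cs :: int list. list_all2 (\<lambda>d c. 0 \<le> c \<and> c < d) ds cs}
    \<and> int (card {cs :: int list. list_all2 (\<lambda>d c. 0 \<le> c \<and> c < d) ds cs}) = prod_list ds"
  if "\<forall>d\<in>set ds. (0 :: int) \<le> d"
  using that
proof (induction ds)
  case Nil
  have "{cs :: int list. list_all2 (\<lambda>d c. 0 \<le> c \<and> c < d) [] cs} = {[]}" by auto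
  then show ?case by simp
next
  case (Cons d ds)
  let ?B = "{cs :: int list. list_all2 (\<lambda>d c. 0 \<le> c \<and> c < d) ds cs}"
  have eq: "{cs :: int list. list_all2 (\<lambda>d c. 0 \<le> c \<and> c < d) (d # ds) cs}
      = (\<lambda>(c, cs). c # cs) ` ({0..<d} \<times> ?B)"
    by (auto simp: list_all2_Cons1)
  have "inj_on (\<lambda>(c, cs). c # cs) ({0..<d} \<times> ?B)" by (auto simp: inj_on_def)
  then show ?case using Cons unfolding eq by (simp add: card_image card_cartesian_product)
qed

context comm_group
begin

lemma power_subgroup_subgroup: "subgroup (power_subgroup G (carrier G) n) G"
proof (rule subgroupI)
  show "inv x \<in> power_subgroup G (carrier G) n" if "x \<in> power_subgroup G (carrier G) n" for x
  proof -
    from that obtain z where "z \<in> carrier G" "x = z [^] n" by (auto simp: power_subgroup_def)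
    then have "inv z \<in> carrier G" "inv x = inv z [^] n" by (simp_all add: nat_pow_inv)
    then show ?thesis by (auto simp: power_subgroup_def)
  qed
  show "x \<otimes> y \<in> power_subgroup G (carrier G) n"
    if "x \<in> power_subgroup G (carrier G) n" "y \<in> power_subgroup G (carrier G) n" for x y
  proof -
    from that obtain u v where "u \<in> carrier G" "x = u [^] n" "v \<in> carrier G" "y = v [^] n"
      by (auto simp: power_subgroup_def)
    then have "u \<otimes> v \<in> carrier G" "x \<otimes> y = (u \<otimes> v) [^] n" by (simp_all add: nat_pow_distrib)
    then show ?thesis by (auto simp: power_subgroup_def)
  qed
qed (auto simp: power_subgroup_def)

text \<open>In a sum of cyclic groups Z/d the multiples of \<open>n\<close> have as quotient the sum
  of the groups Z/gcd(n,d); an infinite summand has \<open>d = 0\<close> and contributes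
  \<open>n\<close>. Coefficient vectors reduced modulo these gcds represent the cosets.\<close>

lemma power_subgroup_index:
  assumes ys: "set ys \<subseteq> carrier G" and span: "int_span G ys = carrier G"
    and len: "length ds = length ys" and "0 < n"
    and rel: "\<And>cs. length cs = length ys \<Longrightarrow> int_comb G ys cs = \<one> \<longleftrightarrow> list_all2 (dvd) ds cs"
  shows "finite (rcosets (power_subgroup G (carrier G) n)) \<and>
    int (card (rcosets (power_subgroup G (carrier G) n))) = prod_list (map (gcd (int n)) ds)"
proof -
  let ?P = "power_subgroup G (carrier G) n" and ?gs = "map (gcd (int n)) ds"
  let ?B = "{cs :: int list. list_all2 (\<lambda>d c. 0 \<le> c \<and> c < d) ?gs cs}"
  let ?f = "\<lambda>cs. ?P #> int_comb G ys cs"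
  have mem: "int_comb G ys cs \<in> ?P \<longleftrightarrow> list_all2 (dvd) ?gs cs" if l: "length cs = length ys" for cs
  proof
    assume "int_comb G ys cs \<in> ?P"
    then obtain z where z: "z \<in> carrier G" "int_comb G ys cs = z [^] n" by (auto simp: power_subgroup_def)
    then have "z \<in> int_span G ys" using span by simp
    then obtain es where es: "length es = length ys" "z = int_comb G ys es" by (rule int_spanE)
    have "int_comb G ys cs = int_comb G ys (map ((*) (int n)) es)"
      using z es int_comb_scale[OF ys es(1), of "int n"] by (simp add: int_pow_int)
    then have "int_comb G ys (map2 (-) cs (map ((*) (int n)) es)) = \<one>"
      using int_comb_eq_iff[OF ys l, of "map ((*) (int n)) es"] es(1) by simp
    then have "list_all2 (dvd) ds (map2 (-) cs (map ((*) (int n)) es))" using rel l es(1) by simp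
    then have dvd: "ds ! i dvd cs ! i - int n * es ! i" if "i < length ys" for i
      using that l es(1) by (auto simp: list_all2_conv_all_nth)
    have "gcd (int n) (ds ! i) dvd cs ! i" if "i < length ys" for i
    proof -
      have "gcd (int n) (ds ! i) dvd cs ! i - int n * es ! i"
        by (rule dvd_trans[OF gcd_dvd2 dvd[OF that]])
      moreover have "gcd (int n) (ds ! i) dvd int n * es ! i" by simp
      ultimately have "gcd (int n) (ds ! i) dvd (cs ! i - int n * es ! i) + int n * es ! i"
        by (rule dvd_add)
      then show ?thesis by simp
    qed
    then show "list_all2 (dvd) ?gs cs" using l len by (auto simp: list_all2_conv_all_nth)
  next
    assume "list_all2 (dvd) ?gs cs"
    then have dvd: "gcd (int n) (ds ! i) dvd cs ! i" if "i < length ys" for i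
      using that l len by (auto simp: list_all2_conv_all_nth)
    have "\<exists>e. ds ! i dvd cs ! i - int n * e" if i: "i < length ys" for i
    proof -
      from dvd[OF i] obtain k where k: "cs ! i = gcd (int n) (ds ! i) * k" ..
      \<comment> \<open>The Bezout identity shows that \<open>u * k\<close> solves the congruence
        for \<open>e\<close> modulo \<open>ds ! i\<close>.\<close>
      obtain u v where uv: "u * int n + v * ds ! i = gcd (int n) (ds ! i)" using bezout_int by blast
      have "cs ! i - int n * (u * k) = ds ! i * (v * k)" unfolding k uv[symmetric] by (simp add: algebra_simps)
      then show ?thesis by (metis dvd_triv_left)
    qed
    then obtain e where e: "\<And>i. i < length ys \<Longrightarrow> ds ! i dvd cs ! i - int n * e i" by metis
    let ?es = "map e [0..<length ys]"
    have "list_all2 (dvd) ds (map2 (-) cs (map ((*) (int n)) ?es))"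
      using e l len by (auto simp: list_all2_conv_all_nth)
    then have "int_comb G ys cs = int_comb G ys (map ((*) (int n)) ?es)"
      using int_comb_eq_iff[OF ys l, of "map ((*) (int n)) ?es"] rel l by simp
    also have "\<dots> = int_comb G ys ?es [^] n"
      using int_comb_scale[OF ys, of ?es "int n"] by (simp add: int_pow_int)
    finally show "int_comb G ys cs \<in> ?P"
      using int_comb_closed[OF ys] by (auto simp: power_subgroup_def)
  qed
  have eq: "?f cs = ?f cs' \<longleftrightarrow> list_all2 (dvd) ?gs (map2 (-) cs cs')"
    if "length cs = length ys" "length cs' = length ys" for cs cs'
    using rcos_eq_iff[OF power_subgroup_subgroup int_comb_closed[OF ys] int_comb_closed[OF ys], of n cs cs']
      int_comb_diff[OF ys that] mem[of "map2 (-) cs cs'"] that by simp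
  have B: "length cs = length ys" if "cs \<in> ?B" for cs
    using that len by (auto dest: list_all2_lengthD)
  have "bij_betw ?f ?B (rcosets ?P)"
  proof (rule bij_betw_imageI)
    show "inj_on ?f ?B"
    proof (rule inj_onI)
      fix cs cs' assume cs: "cs \<in> ?B" and cs': "cs' \<in> ?B" and "?f cs = ?f cs'"
      then have dvd: "list_all2 (dvd) ?gs (map2 (-) cs cs')" using eq B by blast
      show "cs = cs'"
      proof (rule nth_equalityI)
        fix i assume "i < length cs"
        then have i: "i < length ys" using B[OF cs] by simp
        let ?g = "gcd (int n) (ds ! i)"
        have "?g dvd cs ! i - cs' ! i"
          using dvd i B[OF cs] B[OF cs'] len by (auto simp: list_all2_conv_all_nth)
        moreover have "0 \<le> cs ! i" "cs ! i < ?g" "0 \<le> cs' ! i" "cs' ! i < ?g"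
          using cs cs' i B[OF cs] B[OF cs'] len by (auto simp: list_all2_conv_all_nth)
        ultimately show "cs ! i = cs' ! i"
          by (metis mod_eq_dvd_iff mod_pos_pos_trivial)
      qed (simp add: B[OF cs] B[OF cs'])
    qed
    show "?f ` ?B = rcosets ?P"
    proof (rule antisym; rule subsetI)
      fix C assume "C \<in> rcosets ?P"
      then obtain x where "x \<in> carrier G" "C = ?P #> x" by (auto simp: rcosets_image)
      moreover have "x \<in> int_span G ys" using \<open>x \<in> carrier G\<close> span by simp
      ultimately obtain cs where cs: "length cs = length ys" "C = ?f cs" by (auto elim: int_spanE)
      let ?cs = "map2 (\<lambda>c g. c mod g) cs ?gs"
      have "0 < gcd (int n) (ds ! i)" for i using \<open>0 < n\<close> by simp
      then have "?cs \<in> ?B" using cs(1) len by (auto simp: list_all2_conv_all_nth)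
      moreover have "?f cs = ?f ?cs"
        using cs(1) len by (subst eq) (auto simp: list_all2_conv_all_nth minus_mod_eq_mult_div)
      ultimately show "C \<in> ?f ` ?B" using cs(2) by blast
    qed (auto simp: rcosets_image int_comb_closed[OF ys])
  qed
  then show ?thesis
    using finite_card_boxes[of ?gs] by (auto simp: bij_betw_finite bij_betw_same_card)
qed

end

text \<open>Every factor is at most \<open>n\<close>, so the product is maximal only if each factor
  is. The products therefore reveal which \<open>n\<close> divide the whole list.\<close>

lemma prod_gcd_le:
  fixes ds :: "int list"
  assumes "0 < n"
  shows "0 < prod_list (map (gcd n) ds) \<and> prod_list (map (gcd n) ds) \<le> n ^ length ds \<and>
    (prod_list (map (gcd n) ds) = n ^ length ds \<longleftrightarrow> (\<forall>d\<in>set ds. n dvd d))"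
proof (induction ds)
  case (Cons d ds)
  let ?p = "prod_list (map (gcd n) ds)"
  have g: "0 < gcd n d" "gcd n d \<le> n" using assms by (auto intro: gcd_le1_int)
  have pos: "0 < ?p" "?p \<le> n ^ length ds" "0 < n ^ length ds" using Cons assms by auto
  have "gcd n d * ?p \<le> n * n ^ length ds" by (rule mult_mono) (use assms g pos in linarith)+
  moreover have "gcd n d * ?p = n * n ^ length ds \<longleftrightarrow> gcd n d = n \<and> ?p = n ^ length ds"
  proof
    assume eq: "gcd n d * ?p = n * n ^ length ds"
    have "\<not> gcd n d < n"
    proof
      assume "gcd n d < n"
      have "gcd n d * ?p < n * n ^ length ds"
        by (rule mult_less_le_imp_less) (use \<open>gcd n d < n\<close> g pos in linarith)+
      then show False using eq by simp
    qed
    then show "gcd n d = n \<and> ?p = n ^ length ds" using g eq assms by auto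
  qed simp
  moreover have "gcd n d = n \<longleftrightarrow> n dvd d" using assms by (metis abs_of_pos gcd_dvd2 gcd_proj1_iff normalize_int_def)
  ultimately show ?case using g pos Cons by auto
qed simp

text \<open>The head of a divisor chain divides all entries, so the \<open>n\<close> dividing the
  head are those dividing the whole list, and the products reveal them. Nonnegative heads with the
  same divisors agree, and their positive gcd factor cancels.\<close>

lemma divisor_chain_unique:
  fixes ds es :: "int list"
  assumes "length ds = length es" "\<forall>d\<in>set ds. 0 \<le> d" "\<forall>e\<in>set es. 0 \<le> e"
    and "sorted_wrt (dvd) ds" "sorted_wrt (dvd) es"
    and "\<And>n. 0 < n \<Longrightarrow> prod_list (map (gcd n) ds) = prod_list (map (gcd n) es)"
  shows "ds = es"
  using assms
proof (induction ds es rule: list_induct2)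
  case (Cons d ds e es)
  have "n dvd d \<longleftrightarrow> n dvd e" if "0 < n" for n
  proof -
    have "n dvd d \<longleftrightarrow> (\<forall>x\<in>set (d # ds). n dvd x)" using Cons.prems(3) by (auto intro: dvd_trans)
    also have "\<dots> \<longleftrightarrow> (\<forall>x\<in>set (e # es). n dvd x)"
      using prod_gcd_le[OF that, of "d # ds"] prod_gcd_le[OF that, of "e # es"]
        Cons.prems(5)[OF that] Cons.hyps by (metis length_Cons)
    also have "\<dots> \<longleftrightarrow> n dvd e" using Cons.prems(4) by (auto intro: dvd_trans)
    finally show ?thesis .
  qed
  note dvd = this
  have nonneg: "0 \<le> d" "0 \<le> e" using Cons.prems by auto
  have "d = e"
  proof (cases "d = 0 \<or> e = 0")
    case True
    \<comment> \<open>The number exceeds both heads, so it divides a head only if that head is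
      0.\<close>
    have "d + e + 1 dvd d \<longleftrightarrow> d + e + 1 dvd e" using dvd nonneg by simp
    then show ?thesis using True nonneg zdvd_imp_le[of "d + e + 1" d] zdvd_imp_le[of "d + e + 1" e]
      by (cases "d = 0"; cases "e = 0") auto
  next
    case False
    then show ?thesis using dvd[of d] dvd[of e] nonneg by (auto intro: zdvd_antisym_nonneg)
  qed
  moreover have "ds = es"
  proof (rule Cons.IH)
    show "prod_list (map (gcd n) ds) = prod_list (map (gcd n) es)" if "0 < n" for n
      using Cons.prems(5)[OF that] \<open>d = e\<close> that by simp
  qed (use Cons.prems in auto)
  ultimately show ?case by simp
qed simp

text \<open>Sending \<open>f u\<close> to \<open>g u\<close> is well defined and injective as
  \<open>f\<close> and \<open>g\<close> identify the same parameters. \<open>D\<close> need not be a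
  group: words under concatenation will do as well as integer vectors.\<close>

lemma iso_if_common_parametrisation:
  assumes "group A" "group B" and f: "f ` D = carrier A" and g: "g ` D = carrier B"
    and eq: "\<And>u v. u \<in> D \<Longrightarrow> v \<in> D \<Longrightarrow> f u = f v \<longleftrightarrow> g u = g v"
    and m: "\<And>u v. u \<in> D \<Longrightarrow> v \<in> D \<Longrightarrow>
      m u v \<in> D \<and> f (m u v) = f u \<otimes>\<^bsub>A\<^esub> f v \<and> g (m u v) = g u \<otimes>\<^bsub>B\<^esub> g v"
  shows "A \<cong> B"
proof -
  define h where "h x = g (inv_into D f x)" for x
  have h: "h (f u) = g u" if "u \<in> D" for u
  proof -
    have "f (inv_into D f (f u)) = f u" "inv_into D f (f u) \<in> D"
      using that by (auto simp: f_inv_into_f inv_into_into)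
    then show ?thesis using eq that by (simp add: h_def)
  qed
  have "h \<in> iso A B"
  proof (rule isoI)
    show "h \<in> hom A B"
    proof (rule homI)
      show "h x \<in> carrier B" if "x \<in> carrier A" for x
      proof -
        obtain u where "u \<in> D" "x = f u" using \<open>x \<in> carrier A\<close> f by blast
        then show ?thesis using h g by auto
      qed
      show "h (x \<otimes>\<^bsub>A\<^esub> y) = h x \<otimes>\<^bsub>B\<^esub> h y" if xy: "x \<in> carrier A" "y \<in> carrier A" for x y
      proof -
        obtain u v where "u \<in> D" "x = f u" "v \<in> D" "y = f v" using xy f by blast
        then show ?thesis using m[of u v] h[of u] h[of v] h[of "m u v"] by simp
      qed
    qed
    show "bij_betw h (carrier A) (carrier B)"
    proof (rule bij_betw_imageI)
      show "inj_on h (carrier A)" unfolding f[symmetric] by (auto simp: inj_on_def h eq)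
      show "h ` carrier A = carrier B" unfolding f[symmetric] g[symmetric] by (auto simp: h image_image)
    qed
  qed
  then show ?thesis by (auto simp: is_iso_def)
qed

context comm_group
begin

lemma set_subset_int_span: "set xs \<subseteq> carrier G \<Longrightarrow> set xs \<subseteq> int_span G xs"
proof (induction xs)
  case (Cons y ys)
  have "\<one> \<in> int_span G ys"
    using Cons.prems int_comb_zero[of ys] int_spanI[of "replicate (length ys) 0" ys G] by simp
  then have "y \<in> int_span G (y # ys)"
    unfolding int_span_Cons using Cons.prems by (auto intro!: exI[of _ 1] exI[of _ \<one>])
  moreover have "x \<in> int_span G (y # ys)" if "x \<in> set ys" for x
    unfolding int_span_Cons using Cons that by (auto intro!: exI[of _ 0] exI[of _ x])
  ultimately show ?case by auto
qed simp

lemma int_span_generate: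
  assumes "set xs \<subseteq> carrier G" "generate G (set xs) = carrier G"
  shows "int_span G xs = carrier G"
proof (rule antisym; rule subsetI)
  fix v assume "v \<in> carrier G"
  then have "v \<in> generate G (set xs)" using assms(2) by simp
  then show "v \<in> int_span G xs"
  proof induction
    case one
    then show ?case
      using int_comb_zero[OF assms(1)] int_spanI[of "replicate (length xs) 0" xs G] by simp
  next
    case (incl h)
    then show ?case using set_subset_int_span[OF assms(1)] by auto
  next
    case (inv h)
    then have h: "h \<in> carrier G" using assms(1) by auto
    from inv have "h \<in> int_span G xs" using set_subset_int_span[OF assms(1)] by auto
    then obtain cs where cs: "length cs = length xs" "h = int_comb G xs cs" by (rule int_spanE)
    then have "inv h = int_comb G xs (map ((*) (- 1)) cs)"
      using int_comb_scale[OF assms(1) cs(1), of "- 1"] h by (simp add: int_pow_neg)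
    then show ?case using cs(1) by (simp add: int_spanI)
  next
    case (eng h1 h2)
    from eng(3) obtain cs where cs: "length cs = length xs" "h1 = int_comb G xs cs" by (rule int_spanE)
    from eng(4) obtain ds where ds: "length ds = length xs" "h2 = int_comb G xs ds" by (rule int_spanE)
    have "h1 \<otimes> h2 = int_comb G xs (map2 (+) cs ds)"
      using int_comb_add[OF assms(1) cs(1) ds(1)] cs(2) ds(2) by simp
    then show ?case using cs(1) ds(1) by (simp add: int_spanI)
  qed
qed (auto elim!: int_spanE simp: int_comb_closed[OF assms(1)])

text \<open>Units pad generating lists to a common length, so that the divisor lists of two groups
  can be compared entry by entry.\<close>

lemma int_span_pad:
  assumes "set xs \<subseteq> carrier G"
  shows "int_span G (replicate m \<one> @ xs) = int_span G xs"
proof (induction m)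
  case (Suc m)
  have "\<one> [^] (c :: int) \<otimes> v = v" if "v \<in> int_span G xs" for c v
    using that assms by (auto elim!: int_spanE simp: int_comb_closed)
  then have "{\<one> [^] (c :: int) \<otimes> v | c v. v \<in> int_span G xs} = int_span G xs" by force
  then show ?case using Suc by (simp only: replicate_Suc append_Cons int_span_Cons)
qed simp

lemma finitely_generated_int_span:
  assumes "finitely_generated_group G"
  obtains xs where "set xs \<subseteq> carrier G" "int_span G xs = carrier G"
  using assms finite_list int_span_generate unfolding finitely_generated_group_def by metis

lemma finite_power_subgroup_index:
  assumes "finitely_generated_group G" "0 < n"
  shows "finite (rcosets (power_subgroup G (carrier G) n))"
proof -
  obtain xs where "set xs \<subseteq> carrier G" and xs: "int_span G xs = carrier G"
    using finitely_generated_int_span[OF assms(1)] .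
  from adapted_generators[OF this(1)] obtain ys ds where
    "length ys = length xs" "length ds = length xs" "set ys \<subseteq> carrier G" "int_span G ys = int_span G xs"
    "\<And>cs. length cs = length xs \<Longrightarrow> int_comb G ys cs = \<one> \<longleftrightarrow> list_all2 (dvd) ds cs"
    by blast
  then show ?thesis using power_subgroup_index[of ys ds n] xs assms(2) by simp
qed

end

text \<open>After padding, both groups have \<open>k\<close> adapted generators. The indices force
  equal divisor lists, hence the same relations, and integer vectors parametrise both
  groups.\<close>

lemma abelian_iso_if_power_indices_eq:
  assumes "comm_group A" "comm_group B" "finitely_generated_group A" "finitely_generated_group B"
    and index: "\<And>n. 0 < n \<Longrightarrow> card (rcosets\<^bsub>A\<^esub> (power_subgroup A (carrier A) n)) =
      card (rcosets\<^bsub>B\<^esub> (power_subgroup B (carrier B) n))"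
  shows "A \<cong> B"
proof -
  interpret A: comm_group A by fact
  interpret B: comm_group B by fact
  obtain xs where xs: "set xs \<subseteq> carrier A" "int_span A xs = carrier A"
    using A.finitely_generated_int_span[OF assms(3)] .
  obtain xs' where xs': "set xs' \<subseteq> carrier B" "int_span B xs' = carrier B"
    using B.finitely_generated_int_span[OF assms(4)] .
  define k where "k = max (length xs) (length xs')"
  define p where "p = replicate (k - length xs) \<one>\<^bsub>A\<^esub> @ xs"
  define q where "q = replicate (k - length xs') \<one>\<^bsub>B\<^esub> @ xs'"
  have p: "set p \<subseteq> carrier A" "length p = k" "int_span A p = carrier A"
    using xs A.int_span_pad[of xs] by (auto simp: p_def k_def)
  have q: "set q \<subseteq> carrier B" "length q = k" "int_span B q = carrier B"
    using xs' B.int_span_pad[of xs'] by (auto simp: q_def k_def)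
  obtain ys ds where ys: "length ys = k" "length ds = k" "set ys \<subseteq> carrier A"
      "int_span A ys = carrier A" "\<forall>d\<in>set ds. 0 \<le> d" "sorted_wrt (dvd) ds"
    and rel_ys: "\<And>cs. length cs = k \<Longrightarrow> int_comb A ys cs = \<one>\<^bsub>A\<^esub> \<longleftrightarrow> list_all2 (dvd) ds cs"
    using A.adapted_generators[OF p(1)] p(2,3) by metis
  obtain zs es where zs: "length zs = k" "length es = k" "set zs \<subseteq> carrier B"
      "int_span B zs = carrier B" "\<forall>d\<in>set es. 0 \<le> d" "sorted_wrt (dvd) es"
    and rel_zs: "\<And>cs. length cs = k \<Longrightarrow> int_comb B zs cs = \<one>\<^bsub>B\<^esub> \<longleftrightarrow> list_all2 (dvd) es cs"
    using B.adapted_generators[OF q(1)] q(2,3) by metis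
  have "ds = es"
  proof (rule divisor_chain_unique)
    fix n :: int assume "0 < n"
    then have n: "0 < nat n" "n = int (nat n)" by auto
    have "prod_list (map (gcd n) ds) = int (card (rcosets\<^bsub>A\<^esub> (power_subgroup A (carrier A) (nat n))))"
      using A.power_subgroup_index[of ys ds "nat n"] ys rel_ys n by simp
    also have "\<dots> = prod_list (map (gcd n) es)"
      using B.power_subgroup_index[of zs es "nat n"] zs rel_zs n index[OF n(1)] by simp
    finally show "prod_list (map (gcd n) ds) = prod_list (map (gcd n) es)" .
  qed (use ys zs in auto)
  let ?D = "{cs :: int list. length cs = k}"
  show ?thesis
  proof (rule iso_if_common_parametrisation[where D = ?D and f = "int_comb A ys"
        and g = "int_comb B zs" and m = "map2 (+)"])
    show "int_comb A ys ` ?D = carrier A" using ys(1,4) by (simp add: int_span_def)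
    show "int_comb B zs ` ?D = carrier B" using zs(1,4) by (simp add: int_span_def)
    show "int_comb A ys u = int_comb A ys v \<longleftrightarrow> int_comb B zs u = int_comb B zs v"
      if "u \<in> ?D" "v \<in> ?D" for u v
      using that A.int_comb_eq_iff[OF ys(3), of u v] B.int_comb_eq_iff[OF zs(3), of u v]
        rel_ys rel_zs ys(1) zs(1) \<open>ds = es\<close> by simp
    show "map2 (+) u v \<in> ?D \<and>
        int_comb A ys (map2 (+) u v) = int_comb A ys u \<otimes>\<^bsub>A\<^esub> int_comb A ys v \<and>
        int_comb B zs (map2 (+) u v) = int_comb B zs u \<otimes>\<^bsub>B\<^esub> int_comb B zs v"
      if "u \<in> ?D" "v \<in> ?D" for u v
      using that A.int_comb_add[OF ys(3), of u v] B.int_comb_add[OF zs(3), of u v] ys(1) zs(1) by simp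
  qed (rule A.is_group B.is_group)+
qed

section \<open>Comparing the centres\<close>

abbreviation center_group :: "('a, 'm) monoid_scheme \<Rightarrow> ('a, 'm) monoid_scheme" where
  "center_group G \<equiv> G\<lparr>carrier := center G\<rparr>"

context group
begin

lemma center_comm_group: "comm_group (center_group G)"
proof -
  interpret Z: group "center_group G"
    using subgroup.subgroup_is_group[OF center_subgroup is_group] .
  show ?thesis
    by (rule Z.group_comm_groupI) (use centerD center_subset in auto)
qed

lemma power_subgroup_center:
  "power_subgroup (center_group G) (carrier (center_group G)) n = power_subgroup G (center G) n"
  by (simp add: power_subgroup_def nat_pow_consistent[symmetric])

lemma power_subgroup_center_normal: "power_subgroup G (center G) n \<lhd> G"
proof (rule normal_central_subgroup)
  interpret Z: comm_group "center_group G" by (rule center_comm_group)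
  have sub: "subgroup (power_subgroup G (center G) n) (center_group G)"
    using Z.power_subgroup_subgroup[of n] unfolding power_subgroup_center .
  then show "power_subgroup G (center G) n \<subseteq> center G"
    using subgroup.subset by fastforce
  show "subgroup (power_subgroup G (center G) n) G"
    using incl_subgroup[OF center_subgroup sub] .
qed

text \<open>Schreier's argument, simplified because the Schreier generators are central.\<close>

lemma center_finitely_generated:
  assumes "finitely_generated_group G" "finite (rcosets (center G))"
  shows "finitely_generated_group (center_group G)"
proof -
  obtain gs where gs: "generating_sequence G gs"
    using finitely_generated_sequence[OF assms(1)] .
  have gsG: "set gs \<subseteq> carrier G" using gs by (rule generating_sequenceD)
  let ?n = "length gs" and ?Q = "rcosets (center G)"
  have "\<exists>x. x \<in> carrier G \<and> center G #> x = C" if "C \<in> ?Q" for C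
    using that by (auto simp: rcosets_image)
  then obtain r where r: "\<And>C. C \<in> ?Q \<Longrightarrow> r C \<in> carrier G \<and> center G #> r C = C" by metis
  \<comment> \<open>The correction from \<open>x\<close> to the representative of its coset. It is
    central, hence can be moved past any letter.\<close>
  define e where "e x = x \<otimes> inv (r (center G #> x))" for x
  have e: "e x \<in> center G \<and> x = e x \<otimes> r (center G #> x)" if "x \<in> carrier G" for x
  proof -
    have "center G #> x \<in> ?Q" using that by (auto simp: rcosets_image)
    then show ?thesis
      using r[of "center G #> x"] that rcos_eq_iff[OF center_subgroup, of x "r (center G #> x)"]
      by (simp add: e_def m_assoc)
  qed
  \<comment> \<open>The correction of the unit is included because the representative chosen for the
    trivial coset need not be the unit.\<close>
  define E where "E = insert (e \<one>) ((\<lambda>(a, C). e (letter_value G gs a \<otimes> r C)) ` ((UNIV \<times> {..<?n}) \<times> ?Q))"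
  have lr: "letter_value G gs a \<otimes> r C \<in> carrier G" if "snd a < ?n" "C \<in> ?Q" for a C
    using that r letter_value_closed[OF gsG] by auto
  have EZ: "E \<subseteq> center G" using e lr by (auto simp: E_def)
  have EG: "E \<subseteq> carrier G" using EZ center_subset by auto
  have gen_Z: "generate G E \<subseteq> center G" by (rule generate_subgroup_incl[OF EZ center_subgroup])
  \<comment> \<open>Each letter contributes one correction, and these are collected in front of the
    current representative.\<close>
  have words: "\<exists>z\<in>generate G E. word_value G gs w = z \<otimes> r (center G #> word_value G gs w)"
    if "w \<in> words ?n" for w
    using that
  proof (induction w)
    case Nil
    have "e \<one> \<in> generate G E" by (rule generate.incl) (simp add: E_def)
    then show ?case using e[of \<one>] by auto
  next
    case (Cons a w)
    let ?a = "letter_value G gs a" and ?w = "word_value G gs w"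
    let ?C = "center G #> ?w"
    have a: "?a \<in> carrier G" and w: "?w \<in> carrier G"
      using Cons.prems letter_value_closed[OF gsG, of a] word_value_closed[OF gsG, of w] by auto
    then have C: "?C \<in> ?Q" by (auto simp: rcosets_image)
    obtain z where z: "z \<in> generate G E" "?w = z \<otimes> r ?C" using Cons by auto
    have zc: "z \<in> center G" and zG: "z \<in> carrier G" using z(1) gen_Z center_subset by auto
    have ar: "?a \<otimes> r ?C \<in> carrier G" using a C r by simp
    have "?a \<otimes> ?w = ?a \<otimes> (z \<otimes> r ?C)" using z(2) by simp
    also have "\<dots> = z \<otimes> (?a \<otimes> r ?C)"
      using a zG C r centerD[OF zc a] by (simp flip: m_assoc)
    also have "\<dots> = z \<otimes> (e (?a \<otimes> r ?C) \<otimes> r (center G #> (?a \<otimes> r ?C)))"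
      using e[OF ar] by simp
    also have "center G #> (?a \<otimes> r ?C) = center G #> (?a \<otimes> ?w)"
      using normal.rcos_mult_cong[OF normal_central_subgroup[OF center_subgroup subset_refl] _ w a, of "r ?C"] r[OF C]
      by simp
    also have "z \<otimes> (e (?a \<otimes> r ?C) \<otimes> r (center G #> (?a \<otimes> ?w))) =
        (z \<otimes> e (?a \<otimes> r ?C)) \<otimes> r (center G #> (?a \<otimes> ?w))"
      using zG e[OF ar] center_subset r[of "center G #> (?a \<otimes> ?w)"] a w
      by (intro m_assoc[symmetric]) (auto simp: rcosets_image)
    finally have "word_value G gs (a # w) = (z \<otimes> e (?a \<otimes> r ?C)) \<otimes> r (center G #> word_value G gs (a # w))"
      by simp
    moreover have "(a, ?C) \<in> (UNIV \<times> {..<?n}) \<times> ?Q" using Cons.prems C by (cases a) auto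
    then have "e (?a \<otimes> r ?C) \<in> generate G E" unfolding E_def
      by (intro generate.incl insertI2) (rule image_eqI[of _ _ "(a, ?C)"], simp)
    ultimately show ?case using generate.eng[OF z(1)] by blast
  qed
  have "center G \<subseteq> generate G E"
  proof
    fix x assume x: "x \<in> center G"
    then have xG: "x \<in> carrier G" using center_subset by auto
    obtain w where w: "w \<in> words ?n" "word_value G gs w = x" using word_value_surj[OF gs xG] .
    obtain z where z: "z \<in> generate G E" "x = z \<otimes> r (center G #> x)" using words[OF w(1)] w(2) by auto
    have zG: "z \<in> carrier G" using z(1) gen_Z center_subset by auto
    have "center G #> x = center G #> \<one>"
      using x xG rcos_eq_iff[OF center_subgroup xG one_closed] by simp
    moreover have "center G #> \<one> \<in> ?Q" by (auto simp: rcosets_image)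
    ultimately have "r (center G #> x) \<in> carrier G" "e \<one> \<otimes> r (center G #> x) = \<one>"
      using r[of "center G #> \<one>"] e[OF one_closed] by auto
    moreover have "e \<one> \<in> carrier G" using e[OF one_closed] center_subset by auto
    ultimately have "r (center G #> x) = inv (e \<one>)" using inv_equality inv_comm inv_unique' by metis
    moreover have "inv (e \<one>) \<in> generate G E" by (rule generate.inv) (simp add: E_def)
    ultimately show "x \<in> generate G E" using z generate.eng[OF z(1)] by metis
  qed
  then have "generate G E = center G" using gen_Z by auto
  moreover have "finite E" using assms(2) by (simp add: E_def)
  ultimately show ?thesis
    unfolding finitely_generated_group_def
    using EZ generate_consistent[OF EZ center_subgroup] by (intro exI[of _ E]) auto
qed

text \<open>A coset modulo the power subgroup is determined by the coset modulo the centre together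
  with the class, modulo n-th powers, of the central correction to a representative.\<close>

lemma power_subgroup_center_finite_index:
  assumes "finitely_generated_group G" "finite (rcosets (center G))" "0 < n"
  shows "finite (rcosets (power_subgroup G (center G) n))"
    "finite (rcosets\<^bsub>center_group G\<^esub> (power_subgroup G (center G) n))"
proof -
  interpret Z: comm_group "center_group G" by (rule center_comm_group)
  let ?N = "power_subgroup G (center G) n" and ?Q = "rcosets (center G)"
  show fin: "finite (rcosets\<^bsub>center_group G\<^esub> ?N)"
    using Z.finite_power_subgroup_index[OF center_finitely_generated[OF assms(1,2)] assms(3)]
    unfolding power_subgroup_center .
  have "\<exists>x. x \<in> carrier G \<and> center G #> x = C" if "C \<in> ?Q" for C
    using that by (auto simp: rcosets_image)
  then obtain r where r: "\<And>C. C \<in> ?Q \<Longrightarrow> r C \<in> carrier G \<and> center G #> r C = C" by metis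
  let ?f = "\<lambda>x. (center G #> x, ?N #> (x \<otimes> inv (r (center G #> x))))"
  have rx: "r (center G #> x) \<in> carrier G \<and> x \<otimes> inv (r (center G #> x)) \<in> center G"
    if "x \<in> carrier G" for x
  proof -
    have "center G #> x \<in> ?Q" using that by (auto simp: rcosets_image)
    then show ?thesis
      using r[of "center G #> x"] that rcos_eq_iff[OF center_subgroup, of x "r (center G #> x)"] by simp
  qed
  have "?f ` carrier G \<subseteq> ?Q \<times> rcosets\<^bsub>center_group G\<^esub> ?N"
    using rx by (auto simp: rcosets_image Z.rcosets_image)
  then have "finite (?f ` carrier G)" by (rule finite_subset) (use assms(2) fin in auto)
  then have "finite ((\<lambda>x. ?N #> x) ` carrier G)"
  proof (rule finite_image_factor)
    fix x y assume x: "x \<in> carrier G" and y: "y \<in> carrier G" and "?f x = ?f y"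
    then have C: "center G #> x = center G #> y"
      and eq: "?N #> (x \<otimes> inv (r (center G #> y))) = ?N #> (y \<otimes> inv (r (center G #> y)))" by auto
    let ?r = "r (center G #> y)"
    have sub: "subgroup ?N G" by (rule normal_imp_subgroup[OF power_subgroup_center_normal])
    have rG: "?r \<in> carrier G" using rx[OF y] by simp
    have "x \<otimes> inv ?r \<otimes> inv (y \<otimes> inv ?r) \<in> ?N"
      using eq rcos_eq_iff[OF sub, of "x \<otimes> inv ?r" "y \<otimes> inv ?r"] x y rG by simp
    moreover have "x \<otimes> inv ?r \<otimes> inv (y \<otimes> inv ?r) = x \<otimes> inv y"
      using x y rG by (simp add: inv_mult_group m_assoc mult_inv_cancel)
    ultimately show "?N #> x = ?N #> y" using rcos_eq_iff[OF sub x y] by simp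
  qed
  then show "finite (rcosets ?N)" by (simp add: rcosets_image)
qed

lemma word_value_power:
  assumes "set gs \<subseteq> carrier G" "w \<in> words (length gs)"
  shows "concat (replicate n w) \<in> words (length gs) \<and>
    word_value G gs (concat (replicate n w)) = word_value G gs w [^] n"
proof (induction n)
  case (Suc n)
  then show ?case
    using assms nat_pow_Suc2[OF word_value_closed[OF assms], of n] by (simp add: word_value_append)
qed simp

end

text \<open>Cosets of Z(G)^n in Z(G) are represented by words that are central in both groups. If
  two agree modulo Z(H)^n, their quotient word u has value z^n in \<open>H\<close> with z central,
  and z is the value of a word v. The word u v^(-n) is trivial in \<open>H\<close>, so its value in
  \<open>G\<close> lies in Z(G)^n, and so does that of u.\<close>

lemma center_power_index_le:
  fixes G :: "('a, 'm) monoid_scheme" and H :: "('b, 'n) monoid_scheme"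
  assumes "group G" "group H" "Con_group G = Con_group H"
    and fg: "finitely_generated_group G" "finitely_generated_group H"
    and fin: "finite (rcosets\<^bsub>G\<^esub> (center G))" "finite (rcosets\<^bsub>H\<^esub> (center H))"
    and card: "card (rcosets\<^bsub>H\<^esub> (center H)) = card (rcosets\<^bsub>G\<^esub> (center G))"
    and "0 < n"
  shows "card (rcosets\<^bsub>center_group G\<^esub> (power_subgroup G (center G) n))
    \<le> card (rcosets\<^bsub>center_group H\<^esub> (power_subgroup H (center H) n))"
proof -
  interpret G: group G by fact
  interpret H: group H by fact
  interpret ZG: comm_group "center_group G" by (rule G.center_comm_group)
  interpret ZH: comm_group "center_group H" by (rule H.center_comm_group)
  let ?N = "power_subgroup G (center G) n" and ?M = "power_subgroup H (center H) n"
  let ?Q = "rcosets\<^bsub>center_group G\<^esub> ?N"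
  have N: "?N \<lhd> G" "finite (rcosets\<^bsub>G\<^esub> ?N)" "subgroup ?N G" and M: "subgroup ?M H"
    using G.power_subgroup_center_normal G.power_subgroup_center_finite_index[OF fg(1) fin(1) \<open>0 < n\<close>]
      H.power_subgroup_center_normal normal_imp_subgroup by auto
  obtain gs where gs: "generating_sequence G gs"
    using G.finitely_generated_sequence[OF fg(1)] .
  have gsG: "set gs \<subseteq> carrier G" using gs by (rule G.generating_sequenceD)
  obtain hs where hs: "generating_sequence H hs" and len: "length hs = length gs"
    and central: "\<And>w. w \<in> words (length gs) \<Longrightarrow>
      word_value G gs w \<in> center G \<longleftrightarrow> word_value H hs w \<in> center H"
    and rel: "\<And>w. w \<in> words (length gs) \<Longrightarrow> word_value H hs w = \<one>\<^bsub>H\<^esub> \<Longrightarrow> word_value G gs w \<in> ?N"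
    by (rule central_words_transfer[OF assms(1-3) gs fin card N(1,2)]) (rule that)
  have hsH: "set hs \<subseteq> carrier H" using hs by (rule H.generating_sequenceD)
  have "\<exists>w\<in>words (length gs). word_value G gs w \<in> center G \<and> ?N #>\<^bsub>G\<^esub> word_value G gs w = C"
    if "C \<in> ?Q" for C
  proof -
    obtain x where "x \<in> center G" "C = ?N #>\<^bsub>G\<^esub> x"
      using \<open>C \<in> ?Q\<close> by (auto simp: ZG.rcosets_image)
    then show ?thesis using G.word_value_surj[OF gs, of x] G.center_subset by (metis subsetD)
  qed
  then obtain R where R: "\<And>C. C \<in> ?Q \<Longrightarrow> R C \<in> words (length gs) \<and>
      word_value G gs (R C) \<in> center G \<and> ?N #>\<^bsub>G\<^esub> word_value G gs (R C) = C" by metis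
  let ?f = "\<lambda>C. ?M #>\<^bsub>H\<^esub> word_value H hs (R C)"
  show ?thesis
  proof (rule card_inj_on_le)
    show "finite (rcosets\<^bsub>center_group H\<^esub> ?M)"
      using H.power_subgroup_center_finite_index[OF fg(2) fin(2) \<open>0 < n\<close>] by simp
    show "?f ` ?Q \<subseteq> rcosets\<^bsub>center_group H\<^esub> ?M"
      using R central by (auto simp: ZH.rcosets_image)
    show "inj_on ?f ?Q"
    proof (rule inj_onI)
      fix C D assume C: "C \<in> ?Q" and D: "D \<in> ?Q" and eq: "?f C = ?f D"
      let ?u = "R C @ inverse_word (R D)"
      have RC: "R C \<in> words (length gs)" and RD: "R D \<in> words (length gs)" using R C D by auto
      have cl: "word_value H hs (R C) \<in> carrier H" "word_value H hs (R D) \<in> carrier H"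
        "word_value G gs (R C) \<in> carrier G" "word_value G gs (R D) \<in> carrier G"
        using RC RD len by (auto intro!: H.word_value_closed[OF hsH] G.word_value_closed[OF gsG])
      have u: "?u \<in> words (length gs)" using RC RD by simp
      have uH: "word_value H hs ?u = word_value H hs (R C) \<otimes>\<^bsub>H\<^esub> inv\<^bsub>H\<^esub> word_value H hs (R D)"
        using RC RD len by (simp add: H.word_value_append[OF hsH] H.word_value_inverse[OF hsH])
      have uG: "word_value G gs ?u = word_value G gs (R C) \<otimes>\<^bsub>G\<^esub> inv\<^bsub>G\<^esub> word_value G gs (R D)"
        using RC RD by (simp add: G.word_value_append[OF gsG] G.word_value_inverse[OF gsG])
      have "word_value H hs ?u \<in> ?M"
        using eq H.rcos_eq_iff[OF M cl(1,2)] uH by simp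
      then obtain z where z: "z \<in> center H" "word_value H hs ?u = z [^]\<^bsub>H\<^esub> n"
        by (auto simp: power_subgroup_def)
      have "z \<in> carrier H" using z(1) H.center_subset by auto
      then obtain v where v: "v \<in> words (length gs)" "word_value H hs v = z"
        using H.word_value_surj[OF hs] len by metis
      let ?p = "concat (replicate n v)"
      have p: "?p \<in> words (length gs)" "word_value H hs ?p = z [^]\<^bsub>H\<^esub> n"
        "word_value G gs ?p = word_value G gs v [^]\<^bsub>G\<^esub> n"
        using H.word_value_power[OF hsH, of v n] G.word_value_power[OF gsG, of v n] v len by auto
      have "word_value H hs (?u @ inverse_word ?p) = \<one>\<^bsub>H\<^esub>"
        using H.word_value_append[OF hsH, of ?u "inverse_word ?p"] H.word_value_inverse[OF hsH, of ?p]
          u p z \<open>z \<in> carrier H\<close> len by simp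
      then have "word_value G gs (?u @ inverse_word ?p) \<in> ?N"
        using u p by (intro rel) auto
      then have "word_value G gs ?u \<otimes>\<^bsub>G\<^esub> inv\<^bsub>G\<^esub> word_value G gs ?p \<in> ?N"
        using G.word_value_append[OF gsG, of ?u "inverse_word ?p"] G.word_value_inverse[OF gsG, of ?p] u p(1) by simp
      \<comment> \<open>Centrality of \<open>v\<close> is pulled back to \<open>G\<close>; this
        places the n-th power of its value in \<open>?N\<close>.\<close>
      moreover have pN: "word_value G gs ?p \<in> ?N"
        using central[OF v(1)] v(2) z(1) p(3) by (auto simp: power_subgroup_def)
      ultimately have "word_value G gs ?u \<otimes>\<^bsub>G\<^esub> inv\<^bsub>G\<^esub> word_value G gs ?p \<otimes>\<^bsub>G\<^esub> word_value G gs ?p \<in> ?N"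
        by (rule subgroup.m_closed[OF N(3)])
      then have "word_value G gs ?u \<in> ?N"
        using G.word_value_closed[OF gsG u] G.word_value_closed[OF gsG p(1)] by (simp add: G.m_assoc)
      then have "?N #>\<^bsub>G\<^esub> word_value G gs (R C) = ?N #>\<^bsub>G\<^esub> word_value G gs (R D)"
        using G.rcos_eq_iff[OF N(3) cl(3,4)] uG by simp
      then show "C = D" using R C D by metis
    qed
  qed
qed

text \<open>The index inequality is applied in both directions, with unrelated generating tuples;
  only the resulting numbers are compared.\<close>

lemma center_iso:
  fixes G :: "('a, 'm) monoid_scheme" and H :: "('b, 'n) monoid_scheme"
  assumes "group G" "group H" "Con_group G = Con_group H"
    and fg: "finitely_generated_group G" "finitely_generated_group H"
    and fin: "finite (rcosets\<^bsub>G\<^esub> (center G))" "finite (rcosets\<^bsub>H\<^esub> (center H))"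
    and card: "card (rcosets\<^bsub>H\<^esub> (center H)) = card (rcosets\<^bsub>G\<^esub> (center G))"
  shows "center_group G \<cong> center_group H"
proof (rule abelian_iso_if_power_indices_eq)
  interpret G: group G by fact
  interpret H: group H by fact
  show "comm_group (center_group G)" by (rule G.center_comm_group)
  show "comm_group (center_group H)" by (rule H.center_comm_group)
  show "finitely_generated_group (center_group G)" by (rule G.center_finitely_generated[OF fg(1) fin(1)])
  show "finitely_generated_group (center_group H)" by (rule H.center_finitely_generated[OF fg(2) fin(2)])
  show "card (rcosets\<^bsub>center_group G\<^esub> (power_subgroup (center_group G) (carrier (center_group G)) n)) =
      card (rcosets\<^bsub>center_group H\<^esub> (power_subgroup (center_group H) (carrier (center_group H)) n))"
    if "0 < n" for n
    unfolding G.power_subgroup_center H.power_subgroup_center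
    using center_power_index_le[OF assms that]
      center_power_index_le[OF assms(2,1) assms(3)[symmetric] fg(2,1) fin(2,1) card[symmetric] that]
    by (rule antisym)
qed

text \<open>Words parametrise both quotients, and agreement of centrality says that they identify
  the same words. The trivial choice of \<open>N\<close> suffices here.\<close>

lemma central_quotient_iso:
  fixes G :: "('a, 'm) monoid_scheme" and H :: "('b, 'n) monoid_scheme"
  assumes "group G" "group H" "Con_group G = Con_group H"
    and fg: "finitely_generated_group G" "finitely_generated_group H"
    and fin: "finite (rcosets\<^bsub>G\<^esub> (center G))" "finite (rcosets\<^bsub>H\<^esub> (center H))"
    and card: "card (rcosets\<^bsub>H\<^esub> (center H)) = card (rcosets\<^bsub>G\<^esub> (center G))"
  shows "G Mod center G \<cong> H Mod center H"
proof -
  interpret G: group G by fact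
  interpret H: group H by fact
  have NG: "center G \<lhd> G" and NH: "center H \<lhd> H"
    by (auto intro: G.normal_central_subgroup G.center_subgroup H.normal_central_subgroup H.center_subgroup)
  obtain gs where gs: "generating_sequence G gs"
    using G.finitely_generated_sequence[OF fg(1)] .
  have gsG: "set gs \<subseteq> carrier G" using gs by (rule G.generating_sequenceD)
  obtain hs where hs: "generating_sequence H hs" and len: "length hs = length gs"
    and central: "\<And>w. w \<in> words (length gs) \<Longrightarrow>
      word_value G gs w \<in> center G \<longleftrightarrow> word_value H hs w \<in> center H"
    by (rule central_words_transfer[OF assms(1-3) gs fin card G.carrier_normal G.carrier_finite_index])
      (rule that)
  have hsH: "set hs \<subseteq> carrier H" using hs by (rule H.generating_sequenceD)
  let ?D = "words (length gs)"
  let ?f = "\<lambda>w. center G #>\<^bsub>G\<^esub> word_value G gs w" and ?g = "\<lambda>w. center H #>\<^bsub>H\<^esub> word_value H hs w"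
  have "word_value G gs ` ?D = carrier G"
    using G.word_value_closed[OF gsG] G.word_value_surj[OF gs] by blast
  then have f: "?f ` ?D = carrier (G Mod center G)"
    unfolding carrier_FactGroup by (simp add: image_image[symmetric])
  have "word_value H hs ` ?D = carrier H"
    using H.word_value_closed[OF hsH] H.word_value_surj[OF hs] len by (metis (no_types, opaque_lifting) image_iff subsetI subset_antisym)
  then have g: "?g ` ?D = carrier (H Mod center H)"
    unfolding carrier_FactGroup by (simp add: image_image[symmetric])
  show ?thesis
  proof (rule iso_if_common_parametrisation[OF normal.factorgroup_is_group[OF NG]
        normal.factorgroup_is_group[OF NH] f g, where m = "(@)"])
    fix u v assume u: "u \<in> ?D" and v: "v \<in> ?D"
    then have w: "u @ inverse_word v \<in> ?D" by simp
    show "?f u = ?f v \<longleftrightarrow> ?g u = ?g v"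
      using G.word_value_center_iff[OF gsG u v] H.word_value_center_iff[OF hsH, of u v] u v len central[OF w]
      by simp
    have cl: "word_value H hs u \<in> carrier H" "word_value H hs v \<in> carrier H"
      "word_value G gs u \<in> carrier G" "word_value G gs v \<in> carrier G"
      using u v len by (auto intro!: H.word_value_closed[OF hsH] G.word_value_closed[OF gsG])
    show "u @ v \<in> ?D \<and> ?f (u @ v) = ?f u \<otimes>\<^bsub>G Mod center G\<^esub> ?f v
        \<and> ?g (u @ v) = ?g u \<otimes>\<^bsub>H Mod center H\<^esub> ?g v"
      using u v len normal.rcos_sum[OF NG cl(3,4)] normal.rcos_sum[OF NH cl(1,2)]
      by (simp add: G.word_value_append[OF gsG] H.word_value_append[OF hsH])
  qed
qed

section \<open>Rank and Hirsch length\<close>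

text \<open>Lists rather than sets are used, so that a repeated entry counts as a
  dependence.\<close>

definition independent :: "('a, 'm) monoid_scheme \<Rightarrow> 'a list \<Rightarrow> bool" where
  "independent G xs \<longleftrightarrow>
     (\<forall>cs. length cs = length xs \<longrightarrow> int_comb G xs cs = \<one>\<^bsub>G\<^esub> \<longrightarrow> set cs \<subseteq> {0})"

text \<open>The rank enters only through its lower bounds; so no maximum has to be shown to exist,
  and ranks are compared by comparing bounds.\<close>

definition rank_ge :: "('a, 'm) monoid_scheme \<Rightarrow> 'a set \<Rightarrow> nat \<Rightarrow> bool" where
  "rank_ge G M r \<longleftrightarrow> (\<exists>xs. length xs = r \<and> set xs \<subseteq> M \<and> independent G xs)"

lemma rank_ge_0 [simp]: "rank_ge G M 0"
  by (auto simp: rank_ge_def independent_def)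

context comm_group
begin

lemma int_comb_in_subgroup:
  assumes "subgroup M G" "set xs \<subseteq> M"
  shows "int_comb G xs cs \<in> M"
  using assms(2)
proof (induction xs arbitrary: cs)
  case Nil
  then show ?case using subgroup.one_closed[OF assms(1)] by simp
next
  case (Cons x xs)
  then show ?case
    using subgroup_int_pow_closed[OF assms(1)] subgroup.m_closed[OF assms(1)] by simp
qed

lemma rank_ge_trivial: "rank_ge G {\<one>} r \<longleftrightarrow> r = 0"
proof
  assume "rank_ge G {\<one>} r"
  then obtain xs where xs: "length xs = r" "set xs \<subseteq> {\<one>}" "independent G xs"
    by (auto simp: rank_ge_def)
  show "r = 0"
  proof (rule ccontr)
    assume "r \<noteq> 0"
    then obtain y ys where ys: "xs = y # ys" using xs(1) by (cases xs) auto
    have "set ys \<subseteq> carrier G" using xs(2) one_closed unfolding ys by auto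
    then have "int_comb G xs (1 # replicate (length ys) 0) = \<one>"
      using xs(2) int_comb_zero[of ys] by (simp add: ys)
    then have "set (1 # replicate (length ys) 0) \<subseteq> {0 :: int}"
      using xs(3) ys unfolding independent_def by (metis length_Cons length_replicate)
    then show False by simp
  qed
qed simp

text \<open>The \<open>m\<close>-th powers of independent elements are independent, and they lie in
  \<open>M\<close>.\<close>

lemma rank_ge_torsion_quotient:
  assumes "M \<subseteq> N" "N \<subseteq> carrier G" "0 < m" "\<And>x. x \<in> N \<Longrightarrow> x [^] (m :: nat) \<in> M"
  shows "rank_ge G N r \<longleftrightarrow> rank_ge G M r"
proof
  assume "rank_ge G N r"
  then obtain xs where xs: "length xs = r" "set xs \<subseteq> N" "independent G xs"
    by (auto simp: rank_ge_def)
  let ?ys = "map (\<lambda>x. x [^] int m) xs"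
  have scale: "int_comb G (map (\<lambda>x. x [^] int m) xs) cs = int_comb G xs (map ((*) (int m)) cs)"
    if "length cs = length xs" "set xs \<subseteq> carrier G" for xs cs
    using that by (induction cs xs rule: list_induct2) (auto simp: int_pow_pow)
  have "set ?ys \<subseteq> M" using xs(2) assms(4) by (auto simp: int_pow_int)
  moreover have "independent G ?ys"
    unfolding independent_def
  proof (intro allI impI)
    fix cs assume cs: "length cs = length ?ys" "int_comb G ?ys cs = \<one>"
    then have "int_comb G xs (map ((*) (int m)) cs) = \<one>" using scale xs(2) assms(2) by simp
    moreover have "length (map ((*) (int m)) cs) = length xs" using cs(1) by simp
    ultimately have "set (map ((*) (int m)) cs) \<subseteq> {0}" using xs(3) unfolding independent_def by blast
    then show "set cs \<subseteq> {0}" using assms(3) by auto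
  qed
  ultimately show "rank_ge G M r" unfolding rank_ge_def using xs(1) by (metis length_map)
next
  show "rank_ge G M r \<Longrightarrow> rank_ge G N r" using assms(1) by (auto simp: rank_ge_def)
qed

lemma independent_swap:
  assumes "set (y # ys) \<subseteq> carrier G" "i < length ys" "independent G (y # ys)"
  shows "independent G (ys ! i # ys[i := y])"
  unfolding independent_def
proof (intro allI impI)
  fix cs assume l: "length cs = length (ys ! i # ys[i := y])" and rel: "int_comb G (ys ! i # ys[i := y]) cs = \<one>"
  then obtain d ds where cs: "cs = d # ds" "length ds = length ys" by (cases cs) auto
  have "int_comb G (y # ys) (ds ! i # ds[i := d]) = int_comb G (ys ! i # ys[i := y]) (d # ds)"
    using int_comb_swap[OF assms(1), of "ds[i := d]" i "ds ! i"] assms(2) cs(2) by simp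
  then have "int_comb G (y # ys) (ds ! i # ds[i := d]) = \<one>" using rel cs(1) by simp
  moreover have "length (ds ! i # ds[i := d]) = length (y # ys)" using cs(2) by simp
  ultimately have "set (ds ! i # ds[i := d]) \<subseteq> {0}" using assms(3) unfolding independent_def by blast
  then have z: "ds ! i = 0" "set (ds[i := d]) \<subseteq> {0}" by auto
  have "d \<in> set (ds[i := d])" using assms(2) cs(2) by (intro set_update_memI) simp
  then have "d = 0" using z by auto
  moreover have "ds ! j = 0" if "j < length ds" for j
  proof (cases "j = i")
    case False
    then have "ds ! j \<in> set (ds[i := d])" using that by (metis length_list_update nth_list_update_neq nth_mem)
    then show ?thesis using z by auto
  qed (use z in simp)
  ultimately show "set cs \<subseteq> {0}" unfolding cs(1) by (auto simp: in_set_conv_nth)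
qed

text \<open>Upwards, \<open>s\<close> is adjoined: \<phi> kills the rest of a relation and so forces
  the coefficient of \<open>s\<close> to be 0. Downwards, one element outside the kernel is used as
  a pivot to move all others into the kernel. It is enough that \<phi> is nonzero; it need not be
  onto.\<close>

lemma rank_ge_infinite_cyclic_quotient:
  fixes \<phi> :: "'a \<Rightarrow> int"
  assumes M: "subgroup M G" and N: "subgroup N G"
    and hom: "\<And>x y. x \<in> N \<Longrightarrow> y \<in> N \<Longrightarrow> \<phi> (x \<otimes> y) = \<phi> x + \<phi> y"
    and ker: "\<And>x. x \<in> N \<Longrightarrow> \<phi> x = 0 \<longleftrightarrow> x \<in> M" and MN: "M \<subseteq> N"
    and s: "s \<in> N" "\<phi> s \<noteq> 0"
  shows "rank_ge G N (Suc r) \<longleftrightarrow> rank_ge G M r"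
proof -
  have NG: "N \<subseteq> carrier G" using N by (rule subgroup.subset)
  have "\<phi> \<in> hom (G\<lparr>carrier := N\<rparr>) integer_group"
    by (rule homI) (use hom in auto)
  then have "\<phi> (x [^]\<^bsub>G\<lparr>carrier := N\<rparr>\<^esub> c) = \<phi> x [^]\<^bsub>integer_group\<^esub> c" if "x \<in> N" for x and c :: int
    using that hom_int_pow[of \<phi> "G\<lparr>carrier := N\<rparr>" integer_group x c]
      subgroup.subgroup_is_group[OF N is_group] by simp
  then have pow: "\<phi> (x [^] c) = c * \<phi> x" if "x \<in> N" for x and c :: int
    using that int_pow_consistent[OF N that, of c] by (simp add: mult.commute)
  have powN: "x [^] c \<in> N" if "x \<in> N" for x and c :: int
    using subgroup_int_pow_closed[OF N that] .
  show ?thesis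
  proof
    assume "rank_ge G M r"
    then obtain xs where xs: "length xs = r" "set xs \<subseteq> M" "independent G xs"
      by (auto simp: rank_ge_def)
    have "independent G (s # xs)"
      unfolding independent_def
    proof (intro allI impI)
      fix cs assume l: "length cs = length (s # xs)" and rel: "int_comb G (s # xs) cs = \<one>"
      then obtain d ds where cs: "cs = d # ds" "length ds = length xs" by (cases cs) auto
      have v: "int_comb G xs ds \<in> M" by (rule int_comb_in_subgroup[OF M xs(2)])
      have eq: "s [^] d \<otimes> int_comb G xs ds = \<one>" using rel cs(1) by simp
      have "\<phi> (s [^] d \<otimes> int_comb G xs ds) = d * \<phi> s + \<phi> (int_comb G xs ds)"
        using hom[OF powN[OF s(1)], of "int_comb G xs ds" d] v MN pow[OF s(1)] by auto
      moreover have "\<phi> (int_comb G xs ds) = 0" using ker v MN by auto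
      moreover have "\<phi> \<one> = 0" using ker[of \<one>] subgroup.one_closed[OF M] subgroup.one_closed[OF N] by simp
      ultimately have "d = 0" using eq s(2) by simp
      then have "int_comb G xs ds = \<one>" using eq v M NG MN by (simp add: subset_iff)
      then have "set ds \<subseteq> {0}" using xs(3) cs(2) by (simp add: independent_def)
      then show "set cs \<subseteq> {0}" using \<open>d = 0\<close> cs(1) by simp
    qed
    then show "rank_ge G N (Suc r)"
      unfolding rank_ge_def using xs s(1) MN by (intro exI[of _ "s # xs"]) auto
  next
    assume "rank_ge G N (Suc r)"
    then obtain x xs where xs: "length xs = r" "set (x # xs) \<subseteq> N" "independent G (x # xs)"
      by (auto simp: rank_ge_def length_Suc_conv)
    show "rank_ge G M r"
    \<comment> \<open>If all values vanish, the list already lies in \<open>M\<close> and one entry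
      is dropped. Otherwise an entry with nonzero value is brought to the head as pivot.\<close>
    proof (cases "\<forall>z\<in>set (x # xs). \<phi> z = 0")
      case True
      have "independent G xs"
        unfolding independent_def
      proof (intro allI impI)
        fix cs assume "length cs = length xs" "int_comb G xs cs = \<one>"
        then have "length (0 # cs) = length (x # xs)" "int_comb G (x # xs) (0 # cs) = \<one>" by auto
        then have "set (0 # cs) \<subseteq> {0}" using xs(3) unfolding independent_def by blast
        then show "set cs \<subseteq> {0}" by simp
      qed
      moreover have "set xs \<subseteq> M" using True ker xs(2) by auto
      ultimately show ?thesis unfolding rank_ge_def using xs(1) by auto
    next
      case False
      have "\<exists>y ys. length ys = r \<and> set (y # ys) \<subseteq> N \<and> independent G (y # ys) \<and> \<phi> y \<noteq> 0"
      proof (cases "\<phi> x = 0")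
        case True
        with False obtain i where i: "i < length xs" "\<phi> (xs ! i) \<noteq> 0" by (auto simp: in_set_conv_nth)
        have "independent G (xs ! i # xs[i := x])"
          using xs NG by (intro independent_swap[OF _ i(1)]) auto
        moreover have "set (xs ! i # xs[i := x]) \<subseteq> N"
          using xs i set_update_subset_insert[of xs i x] by auto
        ultimately show ?thesis using xs(1) i by (metis length_list_update)
      qed (use xs in blast)
      then obtain y ys where ys: "length ys = r" "set (y # ys) \<subseteq> N" "independent G (y # ys)" "\<phi> y \<noteq> 0"
        by blast
      \<comment> \<open>Cross-multiplied exponents cancel under \<phi>, so no division in the
        integers is needed.\<close>
      let ?f = "\<lambda>x. x [^] \<phi> y \<otimes> y [^] (- \<phi> x)"
      have f: "?f x \<in> M" if "x \<in> N" for x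
      proof -
        have "?f x \<in> N" using powN that ys(2) subgroup.m_closed[OF N] by simp
        moreover have "\<phi> (?f x) = 0"
          using hom[OF powN[OF that, of "\<phi> y"] powN[of y "- \<phi> x"]] pow that ys(2) by simp
        ultimately show ?thesis using ker by simp
      qed
      \<comment> \<open>The exponent \<open>e\<close> collected at the pivot is irrelevant; what
        counts is that the other coefficients are only scaled by \<open>\<phi> y\<close>, which is
        nonzero.\<close>
      have comb: "\<exists>e. int_comb G (map ?f xs) cs = int_comb G (y # xs) (e # map ((*) (\<phi> y)) cs)"
        if "length cs = length xs" "set xs \<subseteq> N" for cs xs
        using that
      proof (induction cs xs rule: list_induct2)
        case Nil
        show ?case by (intro exI[of _ 0]) simp
      next
        case (Cons c cs x xs)
        then obtain e where e: "int_comb G (map ?f xs) cs = int_comb G (y # xs) (e # map ((*) (\<phi> y)) cs)"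
          by auto
        have x: "x \<in> carrier G" and y: "y \<in> carrier G" and X: "set xs \<subseteq> carrier G"
          using Cons.prems NG ys(2) by auto
        have "?f x [^] c = x [^] (\<phi> y * c) \<otimes> y [^] (- \<phi> x * c)"
          using x y by (simp add: int_pow_distrib int_pow_pow)
        then obtain k where "?f x [^] c = x [^] (\<phi> y * c) \<otimes> y [^] (k :: int)" by blast
        then have "int_comb G (map ?f (x # xs)) (c # cs) =
            int_comb G (y # x # xs) ((k + e) # map ((*) (\<phi> y)) (c # cs))"
          using e x y int_comb_closed[OF X] by (simp add: int_pow_mult m_ac)
        then show ?case by blast
      qed
      have "independent G (map ?f ys)"
        unfolding independent_def
      proof (intro allI impI)
        fix cs assume l: "length cs = length (map ?f ys)" and rel: "int_comb G (map ?f ys) cs = \<one>"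
        obtain e where "int_comb G (map ?f ys) cs = int_comb G (y # ys) (e # map ((*) (\<phi> y)) cs)"
          using comb[of cs ys] l ys(2) by auto
        then have "int_comb G (y # ys) (e # map ((*) (\<phi> y)) cs) = \<one>" using rel by simp
        moreover have "length (e # map ((*) (\<phi> y)) cs) = length (y # ys)" using l by simp
        ultimately have "set (e # map ((*) (\<phi> y)) cs) \<subseteq> {0}" using ys(3) unfolding independent_def by blast
        then show "set cs \<subseteq> {0}" using ys(4) by auto
      qed
      moreover have "set (map ?f ys) \<subseteq> M" using f ys(2) by auto
      ultimately show ?thesis unfolding rank_ge_def using ys(1) by (metis length_map)
    qed
  qed
qed

end

lemma rank_ge_iso:
  assumes "comm_group A" "comm_group B" "f \<in> iso A B" "rank_ge A (carrier A) r"
  shows "rank_ge B (carrier B) r"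
proof -
  interpret A: comm_group A by fact
  interpret B: comm_group B by fact
  have hom: "f \<in> hom A B" and inj: "inj_on f (carrier A)" using assms(3) by (auto simp: iso_def bij_betw_def)
  interpret f: group_hom A B f using hom by unfold_locales
  obtain xs where xs: "length xs = r" "set xs \<subseteq> carrier A" "independent A xs"
    using assms(4) by (auto simp: rank_ge_def)
  have comb: "int_comb B (map f xs) cs = f (int_comb A xs cs)" if "set xs \<subseteq> carrier A" for xs cs
    using that by (induction xs arbitrary: cs) (auto simp: A.int_comb_closed f.hom_int_pow)
  have "independent B (map f xs)"
    unfolding independent_def
  proof (intro allI impI)
    fix cs assume l: "length cs = length (map f xs)" and rel: "int_comb B (map f xs) cs = \<one>\<^bsub>B\<^esub>"
    have "f (int_comb A xs cs) = f \<one>\<^bsub>A\<^esub>" using rel comb[OF xs(2)] by simp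
    then have "int_comb A xs cs = \<one>\<^bsub>A\<^esub>"
      by (rule inj_onD[OF inj _ A.int_comb_closed[OF xs(2)] A.one_closed])
    then show "set cs \<subseteq> {0}" using xs(3) l by (simp add: independent_def)
  qed
  moreover have "set (map f xs) \<subseteq> carrier B" using xs(2) by auto
  ultimately show ?thesis unfolding rank_ge_def using xs(1) by (metis length_map)
qed

context group
begin

text \<open>Translates the factors of a series into cosets, products and powers taken in
  \<open>G\<close>.\<close>

lemma
  assumes L: "subgroup L G" and K: "K \<lhd> G\<lparr>carrier := L\<rparr>"
  shows factor_group: "group (G\<lparr>carrier := L\<rparr> Mod K)"
    and factor_carrier: "carrier (G\<lparr>carrier := L\<rparr> Mod K) = (\<lambda>g. K #> g) ` L"
    and factor_subgroup: "subgroup K G" and factor_subset: "K \<subseteq> L"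
    and factor_int_pow: "g \<in> L \<Longrightarrow> (K #> g) [^]\<^bsub>G\<lparr>carrier := L\<rparr> Mod K\<^esub> (n :: int) = K #> (g [^] n)"
    and factor_nat_pow: "g \<in> L \<Longrightarrow> (K #> g) [^]\<^bsub>G\<lparr>carrier := L\<rparr> Mod K\<^esub> (m :: nat) = K #> (g [^] m)"
    and factor_mult: "g \<in> L \<Longrightarrow> h \<in> L \<Longrightarrow> (K #> g) <#> (K #> h) = K #> (g \<otimes> h)"
proof -
  interpret N: normal K "G\<lparr>carrier := L\<rparr>" by (rule K)
  show "group (G\<lparr>carrier := L\<rparr> Mod K)" by (rule N.factorgroup_is_group)
  show "carrier (G\<lparr>carrier := L\<rparr> Mod K) = (\<lambda>g. K #> g) ` L"
    by (simp add: carrier_FactGroup)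
  show "subgroup K G" by (rule incl_subgroup[OF L N.is_subgroup])
  show "K \<subseteq> L" using N.subset by simp
  show "(K #> g) [^]\<^bsub>G\<lparr>carrier := L\<rparr> Mod K\<^esub> n = K #> (g [^] n)" if "g \<in> L"
    using N.FactGroup_int_pow[of g n] that int_pow_consistent[OF L that, of n] by simp
  show "(K #> g) [^]\<^bsub>G\<lparr>carrier := L\<rparr> Mod K\<^esub> m = K #> (g [^] m)" if "g \<in> L"
    using N.FactGroup_pow[of g m] that by (simp flip: nat_pow_consistent)
  show "(K #> g) <#> (K #> h) = K #> (g \<otimes> h)" if "g \<in> L" "h \<in> L"
    using N.rcos_sum[of g h] that by simp
qed

lemma rcos_eq_self_iff:
  assumes "subgroup K G" "g \<in> carrier G"
  shows "K #> g = K \<longleftrightarrow> g \<in> K"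
  using rcos_eq_iff[OF assms one_closed] assms subgroup.subset[OF assms(1)] by simp

lemma cyclic_factor_iff:
  assumes L: "subgroup L G" and K: "K \<lhd> G\<lparr>carrier := L\<rparr>"
  shows "cyclic_group (G\<lparr>carrier := L\<rparr> Mod K) \<longleftrightarrow>
    (\<exists>t\<in>L. \<forall>g\<in>L. \<exists>n :: int. K #> g = K #> (t [^] n))"
proof -
  let ?Q = "G\<lparr>carrier := L\<rparr> Mod K"
  have "(\<lambda>g. K #> g) ` L = range (\<lambda>n :: int. (K #> t) [^]\<^bsub>?Q\<^esub> n) \<longleftrightarrow>
      (\<forall>g\<in>L. \<exists>n :: int. K #> g = K #> (t [^] n))" if "t \<in> L" for t
  proof -
    have "(K #> t) [^]\<^bsub>?Q\<^esub> n \<in> (\<lambda>g. K #> g) ` L" for n :: int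
      using factor_int_pow[OF L K that] subgroup_int_pow_closed[OF L that] by simp
    then have "range (\<lambda>n :: int. (K #> t) [^]\<^bsub>?Q\<^esub> n) \<subseteq> (\<lambda>g. K #> g) ` L" by blast
    then have "(\<lambda>g. K #> g) ` L = range (\<lambda>n :: int. (K #> t) [^]\<^bsub>?Q\<^esub> n) \<longleftrightarrow>
        (\<lambda>g. K #> g) ` L \<subseteq> range (\<lambda>n :: int. (K #> t) [^]\<^bsub>?Q\<^esub> n)" by (intro iffI subset_antisym) simp_all
    then show ?thesis by (simp add: image_subset_iff image_iff factor_int_pow[OF L K that])
  qed
  then show ?thesis
    unfolding group.cyclic_group[OF factor_group[OF L K]] factor_carrier[OF L K] by auto
qed

text \<open>One step of a series, intersected with the centre. If the factor is finite, its order is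
  an exponent that pushes \<open>L \<inter> center G\<close> into \<open>K\<close>. If it is
  infinite, the exponent of a generator \<open>t\<close> modulo \<open>K\<close> is a homomorphism
  from \<open>L\<close> to the integers, nonzero on the intersection because some positive power of
  \<open>t\<close> is central.\<close>

lemma rank_ge_cyclic_factor:
  assumes "finite (rcosets (center G))"
    and L: "subgroup L G" and K: "K \<lhd> G\<lparr>carrier := L\<rparr>"
    and cyc: "cyclic_group (G\<lparr>carrier := L\<rparr> Mod K)"
    and IH: "\<And>r. rank_ge (center_group G) (K \<inter> center G) r \<longleftrightarrow> r \<le> c"
  shows "rank_ge (center_group G) (L \<inter> center G) r \<longleftrightarrow>
    r \<le> (if infinite (carrier (G\<lparr>carrier := L\<rparr> Mod K)) then Suc c else c)"
proof -
  let ?Z = "center_group G" and ?Q = "G\<lparr>carrier := L\<rparr> Mod K"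
  interpret Z: comm_group ?Z by (rule center_comm_group)
  interpret Q: group ?Q by (rule factor_group[OF L K])
  have KG: "subgroup K G" and KL: "K \<subseteq> L" by (rule factor_subgroup[OF L K] factor_subset[OF L K])+
  have LG: "L \<subseteq> carrier G" using L by (rule subgroup.subset)
  have ZL: "subgroup (L \<inter> center G) ?Z" and ZK: "subgroup (K \<inter> center G) ?Z"
    by (auto intro!: subgroup_incl subgroups_Inter_pair L KG center_subgroup)
  show ?thesis
  proof (cases "finite (carrier ?Q)")
    case True
    let ?m = "order ?Q"
    have "0 < ?m" using True Q.order_gt_0_iff_finite by simp
    moreover have "x [^]\<^bsub>?Z\<^esub> ?m \<in> K \<inter> center G" if x: "x \<in> L \<inter> center G" for x
    proof -
      have "K #> (x [^] ?m) = (K #> x) [^]\<^bsub>?Q\<^esub> ?m" using factor_nat_pow[OF L K] x by simp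
      also have "\<dots> = K" using Q.pow_order_eq_1[of "K #> x"] x factor_carrier[OF L K] by auto
      finally have "x [^] ?m \<in> K" using rcos_eq_self_iff[OF KG] x LG by auto
      moreover have "x [^]\<^bsub>?Z\<^esub> ?m = x [^] ?m" by (simp flip: nat_pow_consistent)
      moreover have "x [^]\<^bsub>?Z\<^esub> ?m \<in> center G" using Z.nat_pow_closed[of x ?m] x by simp
      ultimately show ?thesis by simp
    qed
    ultimately have "rank_ge ?Z (L \<inter> center G) r \<longleftrightarrow> rank_ge ?Z (K \<inter> center G) r"
      using KL by (intro Z.rank_ge_torsion_quotient) auto
    then show ?thesis using True IH by simp
  next
    case False
    obtain t where t: "t \<in> L" and tL: "\<And>g. g \<in> L \<Longrightarrow> \<exists>n :: int. K #> g = K #> (t [^] n)"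
      using cyc unfolding cyclic_factor_iff[OF L K] by blast
    have tG: "t \<in> carrier G" using t LG by auto
    \<comment> \<open>The coset of \<open>t\<close> generates an infinite group, so its powers are
      distinct and the exponent below is well defined.\<close>
    have free: "i = j" if eq: "K #> (t [^] i) = K #> (t [^] j)" for i j :: int
    proof -
      have Kt: "K #> t \<in> carrier ?Q" using t factor_carrier[OF L K] by auto
      have "carrier ?Q \<subseteq> range (\<lambda>n :: int. (K #> t) [^]\<^bsub>?Q\<^esub> n)"
        using tL factor_int_pow[OF L K t] factor_carrier[OF L K] by fastforce
      also have "\<dots> \<subseteq> carrier (subgroup_generated ?Q {K #> t})"
        using Q.generate_pow[OF Kt] Kt by (auto simp: carrier_subgroup_generated)
      finally have "infinite (carrier (subgroup_generated ?Q {K #> t}))"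
        using False by (meson finite_subset)
      then show ?thesis
        using Q.infinite_cyclic_subgroup_int[OF Kt] eq factor_int_pow[OF L K t] by metis
    qed
    define \<phi> where "\<phi> g = (THE n :: int. K #> g = K #> (t [^] n))" for g
    have \<phi>: "\<phi> g = n \<longleftrightarrow> K #> g = K #> (t [^] n)" if "g \<in> L" for g n
    proof -
      obtain m :: int where m: "K #> g = K #> (t [^] m)" using tL[OF \<open>g \<in> L\<close>] by blast
      then have "\<phi> g = m" unfolding \<phi>_def using free by (intro the_equality) auto
      then show ?thesis using m free by auto
    qed
    have tpow: "t [^] n \<in> L" for n :: int using subgroup_int_pow_closed[OF L t] .
    have hom: "\<phi> (g \<otimes> h) = \<phi> g + \<phi> h" if g: "g \<in> L" and h: "h \<in> L" for g h
    proof -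
      have "K #> (g \<otimes> h) = (K #> (t [^] \<phi> g)) <#> (K #> (t [^] \<phi> h))"
        using factor_mult[OF L K g h] \<phi>[OF g, of "\<phi> g"] \<phi>[OF h, of "\<phi> h"] by simp
      also have "\<dots> = K #> (t [^] (\<phi> g + \<phi> h))"
        using factor_mult[OF L K tpow tpow] int_pow_mult[OF tG] by simp
      finally show ?thesis using \<phi>[OF subgroup.m_closed[OF L g h]] by simp
    qed
    have ker: "\<phi> g = 0 \<longleftrightarrow> g \<in> K" if "g \<in> L" for g
      using \<phi>[OF that, of 0] rcos_eq_self_iff[OF KG, of g] that LG subgroup.subset[OF KG] by auto
    \<comment> \<open>The order of the quotient by the centre, so that the \<open>m\<close>-th power
      of \<open>t\<close> is central; its exponent \<open>m\<close> is positive.\<close>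
    define m where "m = card (rcosets (center G))"
    interpret GZ: group "G Mod center G"
      using normal.factorgroup_is_group[OF normal_central_subgroup[OF center_subgroup subset_refl]] .
    have carr: "carrier (G Mod center G) = rcosets (center G)" by (simp add: FactGroup_def)
    have "0 < m"
      using GZ.order_gt_0_iff_finite assms(1) by (simp add: m_def order_def carr)
    have "center G #> (t [^] m) = center G"
      using normal.FactGroup_pow[OF normal_central_subgroup[OF center_subgroup subset_refl] tG, of m]
        GZ.pow_order_eq_1[of "center G #> t"] tG by (auto simp: m_def order_def carr rcosets_image)
    then have tm: "t [^] int m \<in> center G"
      using rcos_eq_self_iff[OF center_subgroup, of "t [^] m"] tG by (simp add: int_pow_int)
    have "rank_ge ?Z (L \<inter> center G) (Suc r) \<longleftrightarrow> rank_ge ?Z (K \<inter> center G) r" for r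
    proof (rule Z.rank_ge_infinite_cyclic_quotient[OF ZK ZL])
      show "t [^] int m \<in> L \<inter> center G" using tm tpow by simp
      show "\<phi> (t [^] int m) \<noteq> 0" using \<phi>[OF tpow, of "int m" "int m"] \<open>0 < m\<close> by simp
    qed (use hom ker KL in auto)
    then show ?thesis using IH False by (cases r) auto
  qed
qed

text \<open>The right side refers to the series, the left side only to \<open>G\<close>; this is why
  the number of infinite factors does not depend on the series.\<close>

lemma infinite_factor_count_rank:
  assumes fin: "finite (rcosets (center G))" and series: "cyclic_series G Ks"
  shows "rank_ge (center_group G) (center G) r \<longleftrightarrow> r \<le> infinite_factor_count G Ks"
proof -
  interpret Z: comm_group "center_group G" by (rule center_comm_group)
  let ?inf = "\<lambda>i. infinite (carrier (G\<lparr>carrier := Ks ! Suc i\<rparr> Mod Ks ! i))"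
  have ne: "Ks \<noteq> []" and hd: "hd Ks = {\<one>}" and last: "last Ks = carrier G"
    and sub: "\<And>K. K \<in> set Ks \<Longrightarrow> subgroup K G"
    and fac: "\<And>i. Suc i < length Ks \<Longrightarrow> Ks ! i \<lhd> G\<lparr>carrier := Ks ! Suc i\<rparr> \<and>
        cyclic_group (G\<lparr>carrier := Ks ! Suc i\<rparr> Mod Ks ! i)"
    using series unfolding cyclic_series_def by blast+
  \<comment> \<open>Only the factors below \<open>Ks ! i\<close> are counted, so the induction
    climbs the series from the trivial subgroup.\<close>
  have *: "rank_ge (center_group G) (Ks ! i \<inter> center G) r \<longleftrightarrow> r \<le> card {j. j < i \<and> ?inf j}"
    if "i < length Ks" for i r
    using that
  proof (induction i arbitrary: r)
    case 0
    have "Ks ! 0 \<inter> center G = {\<one>}"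
      using hd ne subgroup.one_closed[OF center_subgroup] by (auto simp: hd_conv_nth)
    then show ?case using Z.rank_ge_trivial by simp
  next
    case (Suc i)
    have "{j. j < Suc i \<and> ?inf j} = (if ?inf i then insert i {j. j < i \<and> ?inf j} else {j. j < i \<and> ?inf j})"
      by (auto simp: less_Suc_eq)
    then have card: "card {j. j < Suc i \<and> ?inf j} =
        (if ?inf i then Suc (card {j. j < i \<and> ?inf j}) else card {j. j < i \<and> ?inf j})"
      by simp
    show ?case
      unfolding card using Suc fac sub by (intro rank_ge_cyclic_factor[OF fin]) auto
  qed
  have "carrier G \<inter> center G = center G" using center_subset by auto
  moreover have "Ks ! (length Ks - 1) = carrier G" using last ne by (simp add: last_conv_nth)
  moreover have "{j. j < length Ks - 1 \<and> ?inf j} = {j. Suc j < length Ks \<and> ?inf j}" by auto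
  ultimately show ?thesis
    using *[of "length Ks - 1" r] ne by (simp add: infinite_factor_count_def)
qed

end

section \<open>Nilpotent groups\<close>

lemma (in group) lower_central_subset: "lower_central G k \<subseteq> carrier G"
proof (induction k)
  case (Suc k)
  then show ?case
    using generate_incl[of "{x \<otimes> y \<otimes> inv x \<otimes> inv y | x y. x \<in> lower_central G k \<and> y \<in> carrier G}"]
    by auto
qed simp

text \<open>Both \<open>G\<close> and \<open>H\<close> will be mapped onto the central quotient of
  \<open>H\<close>, where this identifies the images of their lower central terms.\<close>

lemma (in group_hom) lower_central_image:
  assumes "h ` carrier G = carrier H"
  shows "lower_central H k = h ` lower_central G k"
proof (induction k)
  case (Suc k)
  let ?C = "{x \<otimes>\<^bsub>G\<^esub> y \<otimes>\<^bsub>G\<^esub> inv\<^bsub>G\<^esub> x \<otimes>\<^bsub>G\<^esub> inv\<^bsub>G\<^esub> y | x y. x \<in> lower_central G k \<and> y \<in> carrier G}"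
  let ?D = "{x \<otimes>\<^bsub>H\<^esub> y \<otimes>\<^bsub>H\<^esub> inv\<^bsub>H\<^esub> x \<otimes>\<^bsub>H\<^esub> inv\<^bsub>H\<^esub> y | x y. x \<in> lower_central H k \<and> y \<in> carrier H}"
  have C: "?C \<subseteq> carrier G" using G.lower_central_subset[of k] by auto
  have h: "h (x \<otimes>\<^bsub>G\<^esub> y \<otimes>\<^bsub>G\<^esub> inv\<^bsub>G\<^esub> x \<otimes>\<^bsub>G\<^esub> inv\<^bsub>G\<^esub> y) =
      h x \<otimes>\<^bsub>H\<^esub> h y \<otimes>\<^bsub>H\<^esub> inv\<^bsub>H\<^esub> (h x) \<otimes>\<^bsub>H\<^esub> inv\<^bsub>H\<^esub> (h y)"
    if "x \<in> lower_central G k" "y \<in> carrier G" for x y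
    using that G.lower_central_subset[of k] by (simp add: subset_iff)
  have "?D = h ` ?C"
  proof (rule antisym; rule subsetI)
    fix d assume "d \<in> ?D"
    then obtain x y where "x \<in> lower_central H k" "y \<in> carrier H"
      and d: "d = x \<otimes>\<^bsub>H\<^esub> y \<otimes>\<^bsub>H\<^esub> inv\<^bsub>H\<^esub> x \<otimes>\<^bsub>H\<^esub> inv\<^bsub>H\<^esub> y" by blast
    then have "x \<in> h ` lower_central G k" "y \<in> h ` carrier G" using Suc.IH assms by simp_all
    then obtain u v where "u \<in> lower_central G k" "v \<in> carrier G" "x = h u" "y = h v" by blast
    then show "d \<in> h ` ?C" using h[of u v] d by (intro image_eqI[OF _ CollectI]) auto
  next
    fix d assume "d \<in> h ` ?C"
    then obtain u v where uv: "u \<in> lower_central G k" "v \<in> carrier G"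
      "d = h (u \<otimes>\<^bsub>G\<^esub> v \<otimes>\<^bsub>G\<^esub> inv\<^bsub>G\<^esub> u \<otimes>\<^bsub>G\<^esub> inv\<^bsub>G\<^esub> v)" by blast
    then have "h u \<in> lower_central H k" "h v \<in> carrier H" using Suc.IH by auto
    then show "d \<in> ?D" using h uv by blast
  qed
  then show ?case using generate_img[OF C] by simp
qed (simp add: assms)

text \<open>Where the lower central series of \<open>G\<close> has become trivial, that of
  \<open>H\<close> is trivial modulo the centre, hence central; the next term is generated by
  trivial commutators.\<close>

lemma nilpotent_if_central_quotient_image:
  assumes "group G" "group H" "nilpotent_group G"
    and f: "f \<in> hom G (H Mod center H)" "f ` carrier G = carrier (H Mod center H)"
  shows "nilpotent_group H"
proof -
  interpret G: group G by fact
  interpret H: group H by fact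
  have N: "center H \<lhd> H" by (rule H.normal_central_subgroup[OF H.center_subgroup subset_refl])
  interpret Q: group "H Mod center H" by (rule normal.factorgroup_is_group[OF N])
  interpret f: group_hom G "H Mod center H" f using f(1) by unfold_locales
  interpret p: group_hom H "H Mod center H" "\<lambda>x. center H #>\<^bsub>H\<^esub> x"
    using normal.r_coset_hom_Mod[OF N] by unfold_locales
  obtain k where k: "lower_central G k = {\<one>\<^bsub>G\<^esub>}" using assms(3) by (auto simp: nilpotent_group_def)
  have "(\<lambda>x. center H #>\<^bsub>H\<^esub> x) ` lower_central H k = f ` lower_central G k"
    using f.lower_central_image[OF f(2), of k] p.lower_central_image[of k] by (simp add: carrier_FactGroup)
  then have "center H #>\<^bsub>H\<^esub> x = center H" if "x \<in> lower_central H k" for x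
    using that k by auto
  then have central: "x \<in> center H" if "x \<in> lower_central H k" for x
    using that H.rcos_eq_self_iff[OF H.center_subgroup] H.lower_central_subset by (metis subsetD)
  let ?C = "{x \<otimes>\<^bsub>H\<^esub> y \<otimes>\<^bsub>H\<^esub> inv\<^bsub>H\<^esub> x \<otimes>\<^bsub>H\<^esub> inv\<^bsub>H\<^esub> y | x y. x \<in> lower_central H k \<and> y \<in> carrier H}"
  have "x \<otimes>\<^bsub>H\<^esub> y \<otimes>\<^bsub>H\<^esub> inv\<^bsub>H\<^esub> x \<otimes>\<^bsub>H\<^esub> inv\<^bsub>H\<^esub> y = \<one>\<^bsub>H\<^esub>"
    if x: "x \<in> lower_central H k" and y: "y \<in> carrier H" for x y
  proof -
    have xH: "x \<in> carrier H" using x H.lower_central_subset by auto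
    have "x \<otimes>\<^bsub>H\<^esub> y = y \<otimes>\<^bsub>H\<^esub> x" by (rule H.centerD[OF central[OF x] y])
    then show ?thesis using xH y by (simp add: H.m_assoc)
  qed
  then have "?C \<subseteq> {\<one>\<^bsub>H\<^esub>}" by auto
  then have "generate H ?C \<subseteq> {\<one>\<^bsub>H\<^esub>}" by (rule H.generate_subgroup_incl[OF _ H.triv_subgroup])
  then have "lower_central H (Suc k) = {\<one>\<^bsub>H\<^esub>}" using generate.one[of H ?C] by auto
  then show ?thesis unfolding nilpotent_group_def by blast
qed

section \<open>Existence of a series with cyclic factors\<close>

definition cyclic_chain_to :: "('a, 'm) monoid_scheme \<Rightarrow> 'a set list \<Rightarrow> 'a set \<Rightarrow> bool" where
  "cyclic_chain_to G Ks K \<longleftrightarrow> Ks \<noteq> [] \<and> hd Ks = {\<one>\<^bsub>G\<^esub>} \<and> last Ks = K \<and>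
     (\<forall>K\<in>set Ks. subgroup K G) \<and>
     (\<forall>i. Suc i < length Ks \<longrightarrow>
        Ks ! i \<lhd> G\<lparr>carrier := Ks ! Suc i\<rparr> \<and>
        cyclic_group (G\<lparr>carrier := Ks ! Suc i\<rparr> Mod Ks ! i))"

text \<open>Normality in all of \<open>G\<close>, more than a cyclic series demands, makes
  \<open>G Mod K\<close> available for the next extension.\<close>

definition cyclically_reachable :: "('a, 'm) monoid_scheme \<Rightarrow> 'a set \<Rightarrow> bool" where
  "cyclically_reachable G K \<longleftrightarrow> K \<lhd> G \<and> (\<exists>Ks. cyclic_chain_to G Ks K)"

context group
begin

lemma cyclically_reachable_one: "cyclically_reachable G {\<one>}"
  unfolding cyclically_reachable_def cyclic_chain_to_def
  using one_is_normal triv_subgroup by (intro conjI exI[of _ "[{\<one>}]"]) auto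

text \<open>Modulo \<open>K\<close> the element \<open>x\<close> is central, so the preimage
  \<open>L\<close> of the cyclic group generated by its coset is again normal in \<open>G\<close>,
  and \<open>L\<close> is cyclic over \<open>K\<close>.\<close>

lemma cyclically_reachable_adjoin:
  assumes reach: "cyclically_reachable G K" and x: "x \<in> carrier G"
    and comm: "\<And>g. g \<in> carrier G \<Longrightarrow> x \<otimes> g \<otimes> inv x \<otimes> inv g \<in> K"
  shows "\<exists>L. cyclically_reachable G L \<and> K \<subseteq> L \<and> x \<in> L"
proof -
  from reach obtain Ks where K: "K \<lhd> G" and Ks: "cyclic_chain_to G Ks K"
    by (auto simp: cyclically_reachable_def)
  interpret K: normal K G by (rule K)
  interpret Q: group "G Mod K" by (rule K.factorgroup_is_group)
  interpret p: group_hom G "G Mod K" "\<lambda>g. K #> g"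
    using K.r_coset_hom_Mod by unfold_locales
  let ?Q = "G Mod K" and ?q = "K #> x"
  define L where "L = {g \<in> carrier G. \<exists>n :: int. K #> g = ?q [^]\<^bsub>?Q\<^esub> n}"
  have q: "?q \<in> carrier ?Q" using x by (rule p.hom_closed)
  have commutes: "(K #> g) \<otimes>\<^bsub>?Q\<^esub> (?q [^]\<^bsub>?Q\<^esub> n) = (?q [^]\<^bsub>?Q\<^esub> n) \<otimes>\<^bsub>?Q\<^esub> (K #> g)"
    if g: "g \<in> carrier G" for g and n :: int
  proof (rule Q.commutes_generate)
    show "K #> g \<in> carrier ?Q" using g by (rule p.hom_closed)
    show "{?q} \<subseteq> carrier ?Q" using q by simp
    show "?q [^]\<^bsub>?Q\<^esub> n \<in> generate ?Q {?q}" using Q.generate_pow[OF q] by blast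
    have "x \<otimes> g \<otimes> inv (g \<otimes> x) \<in> K"
      using comm[OF g] x g by (simp add: inv_mult_group m_assoc)
    then have "K #> (x \<otimes> g) = K #> (g \<otimes> x)"
      using rcos_eq_iff[OF K.is_subgroup, of "x \<otimes> g" "g \<otimes> x"] x g by simp
    then show "(K #> g) \<otimes>\<^bsub>?Q\<^esub> s = s \<otimes>\<^bsub>?Q\<^esub> (K #> g)" if "s \<in> {?q}" for s
      using that p.hom_mult[OF x g] p.hom_mult[OF g x] by simp
  qed
  have LI: "g \<in> L" if "g \<in> carrier G" "K #> g = ?q [^]\<^bsub>?Q\<^esub> n" for g and n :: int
    using that by (auto simp: L_def)
  have KL: "K \<subseteq> L"
  proof
    fix g assume g: "g \<in> K"
    then have "K #> g = ?q [^]\<^bsub>?Q\<^esub> (0 :: int)"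
      using rcos_eq_self_iff[OF K.is_subgroup, of g] by simp
    then show "g \<in> L" using g by (intro LI[of g 0]) auto
  qed
  have xL: "x \<in> L" using x q by (intro LI[of x 1]) simp_all
  have L_sub: "subgroup L G"
  proof (rule subgroupI)
    show "L \<subseteq> carrier G" by (auto simp: L_def)
    show "L \<noteq> {}" using xL by auto
    fix g assume "g \<in> L"
    then obtain n :: int where g: "g \<in> carrier G" "K #> g = ?q [^]\<^bsub>?Q\<^esub> n" by (auto simp: L_def)
    have "K #> inv g = inv\<^bsub>?Q\<^esub> (K #> g)" using p.hom_inv[OF g(1)] by simp
    also have "\<dots> = ?q [^]\<^bsub>?Q\<^esub> (- n)" using g(2) Q.int_pow_neg[OF q, of n] by simp
    finally show "inv g \<in> L" using g(1) by (intro LI) auto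
    fix h assume "h \<in> L"
    then obtain m :: int where h: "h \<in> carrier G" "K #> h = ?q [^]\<^bsub>?Q\<^esub> m" by (auto simp: L_def)
    have "K #> (g \<otimes> h) = ?q [^]\<^bsub>?Q\<^esub> (n + m)"
      using p.hom_mult[OF g(1) h(1)] g(2) h(2) Q.int_pow_mult[OF q, of n m] by simp
    then show "g \<otimes> h \<in> L" using g(1) h(1) by (intro LI) auto
  qed
  have L_normal: "L \<lhd> G"
    unfolding normal_inv_iff
  proof (intro conjI ballI L_sub)
    fix a g assume a: "a \<in> carrier G" and "g \<in> L"
    then obtain n :: int where g: "g \<in> carrier G" "K #> g = ?q [^]\<^bsub>?Q\<^esub> n" by (auto simp: L_def)
    have "K #> (a \<otimes> g \<otimes> inv a) = (K #> a) \<otimes>\<^bsub>?Q\<^esub> (K #> g) \<otimes>\<^bsub>?Q\<^esub> inv\<^bsub>?Q\<^esub> (K #> a)"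
      using a g(1) p.hom_mult p.hom_inv by (metis inv_closed m_closed)
    also have "\<dots> = ?q [^]\<^bsub>?Q\<^esub> n \<otimes>\<^bsub>?Q\<^esub> (K #> a) \<otimes>\<^bsub>?Q\<^esub> inv\<^bsub>?Q\<^esub> (K #> a)"
      unfolding g(2) using commutes[OF a, of n] by simp
    also have "\<dots> = ?q [^]\<^bsub>?Q\<^esub> n"
      using q p.hom_closed[OF a] Q.int_pow_closed[OF q, of n] Q.m_assoc Q.r_inv Q.r_one Q.inv_closed by metis
    finally show "a \<otimes> g \<otimes> inv a \<in> L" using a g(1) by (intro LI) auto
  qed
  have KL_normal: "K \<lhd> G\<lparr>carrier := L\<rparr>" by (rule normal_restrict_supergroup[OF L_sub K KL])
  have "cyclic_group (G\<lparr>carrier := L\<rparr> Mod K)"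
    unfolding cyclic_factor_iff[OF L_sub KL_normal]
  proof (intro bexI[of _ x] xL ballI)
    fix g assume "g \<in> L"
    then obtain n :: int where "K #> g = ?q [^]\<^bsub>?Q\<^esub> n" by (auto simp: L_def)
    then show "\<exists>n :: int. K #> g = K #> (x [^] n)" using K.FactGroup_int_pow[OF x, of n] by auto
  qed
  \<comment> \<open>Only the factor of \<open>L\<close> by \<open>K\<close>, the last member of
    \<open>Ks\<close>, is new.\<close>
  then have "cyclic_chain_to G (Ks @ [L]) L"
    using Ks L_sub KL_normal unfolding cyclic_chain_to_def
    by (auto simp: nth_append last_conv_nth less_Suc_eq not_less_eq split: if_splits)
      (metis One_nat_def Suc_lessI diff_Suc_1)+
  then show ?thesis unfolding cyclically_reachable_def using L_normal KL xL by blast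
qed

lemma cyclically_reachable_adjoin_finite:
  assumes "finite S" "S \<subseteq> carrier G" "cyclically_reachable G K"
    and "\<And>x g. x \<in> S \<Longrightarrow> g \<in> carrier G \<Longrightarrow> x \<otimes> g \<otimes> inv x \<otimes> inv g \<in> K"
  shows "\<exists>L. cyclically_reachable G L \<and> K \<subseteq> L \<and> S \<subseteq> L"
  using assms
proof (induction S)
  case (insert x S)
  then obtain L where L: "cyclically_reachable G L" "K \<subseteq> L" "S \<subseteq> L" by auto
  have "\<exists>M. cyclically_reachable G M \<and> L \<subseteq> M \<and> x \<in> M"
    by (rule cyclically_reachable_adjoin[OF L(1)]) (use insert.prems L in auto)
  then show ?case using L by blast
qed blast

text \<open>Central generators are adjoined first, then the lower central series is climbed from its
  trivial end. Commutators with elements of a term lie in the next term, which has already been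
  absorbed. Once the centre is included, finitely many representatives modulo the centre stand for a
  whole term.\<close>

lemma cyclic_series_exists:
  assumes fg: "finitely_generated_group G" and fin: "finite (rcosets (center G))"
    and nil: "nilpotent_group G"
  shows "\<exists>Ks. cyclic_series G Ks"
proof -
  obtain k where k: "lower_central G k = {\<one>}" using nil by (auto simp: nilpotent_group_def)
  obtain S where S: "finite S" "S \<subseteq> center G" "generate G S = center G"
    using center_finitely_generated[OF fg fin] generate_consistent[OF _ center_subgroup]
    by (auto simp: finitely_generated_group_def)
  have "x \<otimes> g \<otimes> inv x \<otimes> inv g = \<one>" if "x \<in> S" "g \<in> carrier G" for x g
  proof -
    have "x \<in> center G" "x \<in> carrier G" using that S(2) center_subset by auto
    then show ?thesis using centerD[of x g] that(2) by (simp add: m_assoc)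
  qed
  then obtain K\<^sub>0 where K\<^sub>0: "cyclically_reachable G K\<^sub>0" "S \<subseteq> K\<^sub>0"
    using cyclically_reachable_adjoin_finite[OF S(1) _ cyclically_reachable_one] S(2) center_subset
    by (metis insertI1 subset_trans)
  have ZK: "center G \<subseteq> K\<^sub>0"
    using generate_subgroup_incl[OF K\<^sub>0(2)] K\<^sub>0(1) normal_imp_subgroup S(3)
    by (auto simp: cyclically_reachable_def)
  \<comment> \<open>Here \<open>j\<close> counts the terms absorbed from the trivial end.
    Subtraction is truncated, so nothing new is claimed beyond \<open>j = k\<close>.\<close>
  have "\<exists>K. cyclically_reachable G K \<and> center G \<subseteq> K \<and> lower_central G (k - j) \<subseteq> K" for j
  proof (induction j)
    case 0
    have "\<one> \<in> K\<^sub>0" using ZK subgroup.one_closed[OF center_subgroup] by auto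
    then show ?case using K\<^sub>0(1) ZK k by auto
  next
    case (Suc j)
    then obtain K where K: "cyclically_reachable G K" "center G \<subseteq> K" "lower_central G (k - j) \<subseteq> K"
      by blast
    show ?case
    proof (cases "j < k")
      case False
      then show ?thesis using K by auto
    next
      case True
      let ?i = "k - Suc j"
      have i: "k - j = Suc ?i" using True by simp
      have "finite ((\<lambda>x. center G #> x) ` lower_central G ?i)"
        using fin by (rule finite_subset[rotated]) (use lower_central_subset[of ?i] in \<open>auto simp: rcosets_image\<close>)
      \<comment> \<open>One element of the term for each coset of the centre that the term
        meets.\<close>
      then obtain T where T: "T \<subseteq> lower_central G ?i" "finite T"
        "(\<lambda>x. center G #> x) ` lower_central G ?i = (\<lambda>x. center G #> x) ` T"
        using finite_subset_image[OF _ subset_refl] by metis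
      have TG: "T \<subseteq> carrier G" using T(1) lower_central_subset by blast
      have "x \<otimes> g \<otimes> inv x \<otimes> inv g \<in> K" if "x \<in> T" "g \<in> carrier G" for x g
      proof -
        have "x \<otimes> g \<otimes> inv x \<otimes> inv g \<in> lower_central G (Suc ?i)"
          using that T(1) by (auto intro!: generate.incl)
        then show ?thesis using K(3) i by auto
      qed
      then obtain L where L: "cyclically_reachable G L" "K \<subseteq> L" "T \<subseteq> L"
        using cyclically_reachable_adjoin_finite[OF T(2) TG K(1)] by blast
      have sub: "subgroup L G" using L(1) normal_imp_subgroup by (auto simp: cyclically_reachable_def)
      have "lower_central G ?i \<subseteq> L"
      proof
        fix y assume y: "y \<in> lower_central G ?i"
        then have yG: "y \<in> carrier G" using lower_central_subset by auto
        obtain x where x: "x \<in> T" "center G #> y = center G #> x" using y T(3) by blast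
        then have xG: "x \<in> carrier G" using TG by auto
        have "y \<otimes> inv x \<in> L" using rcos_eq_iff[OF center_subgroup yG xG] x(2) K(2) L(2) by auto
        then have "y \<otimes> inv x \<otimes> x \<in> L" using x(1) L(3) subgroup.m_closed[OF sub] by auto
        then show "y \<in> L" using yG xG by (simp add: m_assoc)
      qed
      then show ?thesis using L K(2) by blast
    qed
  qed
  from this[of k] obtain K where "cyclically_reachable G K" "carrier G \<subseteq> K" by auto
  moreover have "K \<subseteq> carrier G" if "K \<lhd> G" using that normal_imp_subgroup subgroup.subset by blast
  ultimately show ?thesis
    unfolding cyclically_reachable_def cyclic_chain_to_def cyclic_series_def by blast
qed

text \<open>A series exists and all series give the same count, so the description operator in
  \<open>hirsch_length\<close> picks that count.\<close>

lemma rank_ge_center_hirsch_length: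
  assumes "finitely_generated_group G" and fin: "finite (rcosets (center G))" and "nilpotent_group G"
  shows "rank_ge (center_group G) (center G) r \<longleftrightarrow> r \<le> hirsch_length G"
proof -
  obtain Ks where Ks: "cyclic_series G Ks" using cyclic_series_exists[OF assms] by blast
  have unique: "infinite_factor_count G Ls = infinite_factor_count G Ks" if "cyclic_series G Ls" for Ls
    using infinite_factor_count_rank[OF fin Ks] infinite_factor_count_rank[OF fin that]
    by (metis order_antisym order_refl)
  have "hirsch_length G = infinite_factor_count G Ks"
    unfolding hirsch_length_def
  proof (rule the_equality)
    show "\<exists>Ls. cyclic_series G Ls \<and> infinite_factor_count G Ls = infinite_factor_count G Ks"
      using Ks by blast
    show "h = infinite_factor_count G Ks" if "\<exists>Ls. cyclic_series G Ls \<and> infinite_factor_count G Ls = h" for h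
    proof -
      from that obtain Ls where Ls: "cyclic_series G Ls" "infinite_factor_count G Ls = h" by (elim exE conjE)
      show ?thesis by (rule trans[OF Ls(2)[symmetric] unique[OF Ls(1)]])
    qed
  qed
  then show ?thesis using infinite_factor_count_rank[OF fin Ks] by simp
qed

end

theorem theorem3p6:
  fixes G :: "('a, 'm) monoid_scheme" and H :: "('b, 'n) monoid_scheme"
  assumes "group G" and "finitely_generated_group G"
    and "nilpotent_group G" and "FC_group G"
    and "group H" and "finitely_generated_group H"
    and "configuration_equivalent G H"
  shows "nilpotent_group H \<and> FC_group H \<and>
    G\<lparr>carrier := center G\<rparr> \<cong> H\<lparr>carrier := center H\<rparr> \<and>
    G Mod center G \<cong> H Mod center H \<and>
    hirsch_length G = hirsch_length H"
proof -
  interpret G: group G by fact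
  interpret H: group H by fact
  have con: "Con_group G = Con_group H" using assms(7) by (simp add: configuration_equivalent_def)
  have finG: "finite (rcosets\<^bsub>G\<^esub> (center G))" by (rule G.center_finite_index[OF assms(2,4)])
  have le: "finite (rcosets\<^bsub>H\<^esub> (center H)) \<and>
      card (rcosets\<^bsub>H\<^esub> (center H)) \<le> card (rcosets\<^bsub>G\<^esub> (center G))"
    by (rule center_index_le[OF assms(1,5) con assms(6) finG])
  then have finH: "finite (rcosets\<^bsub>H\<^esub> (center H))" ..
  \<comment> \<open>The reverse inequality needs the finiteness of the index in \<open>H\<close>
    just obtained.\<close>
  have card: "card (rcosets\<^bsub>H\<^esub> (center H)) = card (rcosets\<^bsub>G\<^esub> (center G))"
    using le center_index_le[OF assms(5,1) con[symmetric] assms(2) finH] by simp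
  have center: "center_group G \<cong> center_group H"
    by (rule center_iso[OF assms(1,5) con assms(2,6) finG finH card])
  have quotient: "G Mod center G \<cong> H Mod center H"
    by (rule central_quotient_iso[OF assms(1,5) con assms(2,6) finG finH card])
  \<comment> \<open>\<open>G\<close> maps onto its own central quotient and thereby onto that of
    \<open>H\<close>.\<close>
  have nil: "nilpotent_group H"
  proof -
    obtain \<phi> where "\<phi> \<in> iso (G Mod center G) (H Mod center H)" using quotient by (auto simp: is_iso_def)
    then have \<phi>: "\<phi> \<in> hom (G Mod center G) (H Mod center H)"
      "\<phi> ` carrier (G Mod center G) = carrier (H Mod center H)" by (auto simp: iso_def bij_betw_def)
    have N: "center G \<lhd> G" by (rule G.normal_central_subgroup[OF G.center_subgroup subset_refl])
    show ?thesis
    proof (rule nilpotent_if_central_quotient_image[OF assms(1,5,3)])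
      show "\<phi> \<circ> (\<lambda>x. center G #>\<^bsub>G\<^esub> x) \<in> hom G (H Mod center H)"
        by (rule hom_compose[OF normal.r_coset_hom_Mod[OF N] \<phi>(1)])
      show "(\<phi> \<circ> (\<lambda>x. center G #>\<^bsub>G\<^esub> x)) ` carrier G = carrier (H Mod center H)"
        unfolding image_comp[symmetric] using \<phi>(2) by (simp add: carrier_FactGroup)
    qed
  qed
  have "rank_ge (center_group G) (center G) r \<longleftrightarrow> rank_ge (center_group H) (center H) r" for r
  proof -
    obtain \<psi> where \<psi>: "\<psi> \<in> iso (center_group G) (center_group H)" using center by (auto simp: is_iso_def)
    interpret ZG: comm_group "center_group G" by (rule G.center_comm_group)
    have \<psi>': "inv_into (carrier (center_group G)) \<psi> \<in> iso (center_group H) (center_group G)"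
      by (rule ZG.iso_set_sym[OF \<psi>])
    show ?thesis
      using rank_ge_iso[OF G.center_comm_group H.center_comm_group \<psi>, of r]
        rank_ge_iso[OF H.center_comm_group G.center_comm_group \<psi>', of r] by auto
  qed
  then have "hirsch_length G = hirsch_length H"
    using G.rank_ge_center_hirsch_length[OF assms(2) finG assms(3)]
      H.rank_ge_center_hirsch_length[OF assms(6) finH nil] by (metis order_antisym order_refl)
  then show ?thesis
    using nil H.FC_group_if_center_finite_index[OF finH] center quotient by blast
qed

end
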